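(* There exist constants $c_1,c_2>0$, independent of $h$ and of how $\Gamma$ cuts the triangulation, such that $$c_1\,(\nabla u,\nabla u)_{\Omega_h}\le (A_0u,u)_{\Omega_h}=a_h(u,u)\le c_2\,(\nabla u,\nabla u)_{\Omega_h}\quad\text{for all }u\in V_h^0 ;$$ that is, $A_0$ is uniformly equivalent to the standard finite element discretization in $V_h^0$ of the Poisson equation with zero Dirichlet boundary conditions on $\Omega_h$.
   Context: Geometry and mesh. Let $d\in\{2,3\}$, $\Omega\subset\mathbb{R}^d$ an open connected Lipschitz domain, $\Gamma=\partial\Omega$ with outward unit normal $n_\Gamma$. Let $\Omega^\ast\supset\Omega$ be a polygonal (polyhedral) domain with a family $\{\mathcal{T}_h^\ast\}_{h>0}$ of shape regular (not necessarily quasi-uniform) simplicial triangulations; $h_T$, $h_F$ denote the diameters of a simplex $T$, a face $F$. Define $\mathcal{T}_h=\{T\in\mathcal{T}_h^\ast : \mathrm{meas}_{d-1}(T\cap\Omega)>0\}$, $\Omega_h=\bigcup_{T\in\mathcal{T}_h}T$, $\mathcal{T}_h^\Gamma=\{T\in\mathcal{T}_h: T\cap\Gamma\ne\emptyset\}$. Standing assumption ($\Gamma$ sufficiently resolved, $h$ sufficiently small): $\mathcal{T}_h^\Gamma=\{T\in\mathcal{T}_h: T\cap\partial\Omega_h\neq\emptyset\}$. Finite element spaces. For fixed $k\ge1$, $V_h=\{v_h\in C(\Omega_h): v_h|_T\in\mathcal{P}_k\ \forall T\in\mathcal{T}_h\}$ and $V_h^0=\{v_h\in V_h: v_h|_{\partial\Omega_h}=0\}$.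 Bilinear forms. $(\cdot,\cdot)_\omega$ is the $L^2(\omega)$ scalar product; $(h^{-1}u,v)_\Gamma:=\sum_{T\in\mathcal{T}_h^\Gamma}h_T^{-1}(u,v)_{T\cap\Gamma}$. With fixed $\gamma,\beta>0$, $\mathcal{F}_g$ the set of faces $F$ of simplices $T\in\mathcal{T}_h^\Gamma$ with $F\not\subset\partial\Omega_h$, $[\![\cdot]\!]$ the jump across $F$, $\partial_n$ the derivative normal to $F$, $$a_h(u,v)=(\nabla u,\nabla v)_\Omega-(n_\Gamma\cdot\nabla u,v)_\Gamma-(u,n_\Gamma\cdot\nabla v)_\Gamma+\gamma(h^{-1}u,v)_\Gamma+\beta\sum_{\ell=1}^k\sum_{F\in\mathcal{F}_g}h_F^{2\ell-1}([\![\partial_n^\ell u]\!],[\![\partial_n^\ell v]\!])_F .$$ Standing assumption: $\gamma$ is sufficiently large; then, by a known result from the literature taken as background, $a_h(v_h,v_h)$ is equivalent, for all $v_h\in V_h$, to $\|v_h\|_b^2:=\|\nabla v_h\|_{\Omega_h}^2+\gamma(h^{-1}v_h,v_h)_\Gamma$, with constants independent of $h$ and of how $\Gamma$ cuts the triangulation. The operator $A_0:V_h^0\to V_h^0$ is defined by $(A_0u,v)_{\Omega_h}=a_h(u,v)$ for all $u,v\in V_h^0$. Constants "independent of $h$ and of how $\Gamma$ cuts the triangulation" may depend only on fixed data such as $d,k,\gamma,\beta$, $\Omega$ and the shape regularity of the family. *)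

theory Defs
  imports "HOL-Analysis.Analysis"
begin

section \<open>Hausdorff measure\<close>

definition hausdorff_cost :: "nat \<Rightarrow> 'a::metric_space set \<Rightarrow> ennreal" where
  "hausdorff_cost s C =
     (if C = {} then 0 else ennreal (unit_ball_vol (real s) * (diameter C / 2) ^ s))"

definition hausdorff_premeasure :: "nat \<Rightarrow> real \<Rightarrow> 'a::metric_space set \<Rightarrow> ennreal" where
  "hausdorff_premeasure s \<delta> A =
     (INF C \<in> {C :: nat \<Rightarrow> 'a set. A \<subseteq> (\<Union>i. C i) \<and> (\<forall>i. bounded (C i) \<and> diameter (C i) \<le> \<delta>)}.
        (\<Sum>i. hausdorff_cost s (C i)))"

definition hausdorff_outer :: "nat \<Rightarrow> 'a::metric_space set \<Rightarrow> ennreal" where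
  "hausdorff_outer s A = (SUP \<delta> \<in> {0<..}. hausdorff_premeasure s \<delta> A)"

text \<open>The measure lives on the Caratheodory-measurable sets. That it is a measure, is given by
  \<open>hausdorff_outer\<close> there, and measures every Borel set is checked below (otherwise
  \<open>measure_of\<close> would silently produce the zero measure).\<close>

definition hausdorff_measure :: "nat \<Rightarrow> 'a::metric_space measure" where
  "hausdorff_measure s =
     measure_of UNIV (lambda_system UNIV UNIV (hausdorff_outer s)) (hausdorff_outer s)"

lemma hausdorff_premeasure_mono:
  "A \<subseteq> B \<Longrightarrow> hausdorff_premeasure s \<delta> A \<le> hausdorff_premeasure s \<delta> B"
  unfolding hausdorff_premeasure_def by (rule INF_superset_mono) auto

lemma hausdorff_premeasure_antimono:
  "\<delta> \<le> \<epsilon> \<Longrightarrow> hausdorff_premeasure s \<epsilon> A \<le> hausdorff_premeasure s \<delta> A"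
  unfolding hausdorff_premeasure_def by (rule INF_superset_mono) (auto intro: order_trans)

lemma hausdorff_premeasure_empty:
  "\<delta> > 0 \<Longrightarrow> hausdorff_premeasure s \<delta> {} = 0"
proof -
  assume "\<delta> > 0"
  then have "hausdorff_premeasure s \<delta> ({} :: 'a set) \<le> (\<Sum>i::nat. hausdorff_cost s ({} :: 'a set))"
    unfolding hausdorff_premeasure_def by (intro INF_lower) auto
  then show ?thesis by (simp add: hausdorff_cost_def)
qed

lemma hausdorff_premeasure_subadditive:
  fixes A :: "nat \<Rightarrow> 'a::metric_space set"
  shows "hausdorff_premeasure s \<delta> (\<Union>n. A n) \<le> (\<Sum>n. hausdorff_premeasure s \<delta> (A n))"
proof (rule ennreal_le_epsilon)
  fix e :: real
  assume "0 < e" and fin: "(\<Sum>n. hausdorff_premeasure s \<delta> (A n)) < top"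
  then have *: "\<And>n. hausdorff_premeasure s \<delta> (A n) < hausdorff_premeasure s \<delta> (A n) + e * (1/2)^Suc n"
    by (auto simp add: less_top dest!: ennreal_suminf_lessD)
  have "\<exists>C. A n \<subseteq> (\<Union>i. C i) \<and> (\<forall>i. bounded (C i) \<and> diameter (C i) \<le> \<delta>) \<and>
      (\<Sum>i. hausdorff_cost s (C i)) \<le> hausdorff_premeasure s \<delta> (A n) + e * (1/2)^Suc n" for n
    using *[of n, unfolded hausdorff_premeasure_def[of s \<delta> "A n"] INF_less_iff]
    unfolding hausdorff_premeasure_def[of s \<delta> "A n"] by (auto intro: less_imp_le)
  then obtain B :: "nat \<Rightarrow> nat \<Rightarrow> 'a set" where
      B1: "\<And>n. A n \<subseteq> (\<Union>i. B n i)"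
    and B2: "\<And>n i. bounded (B n i) \<and> diameter (B n i) \<le> \<delta>"
    and B3: "\<And>n. (\<Sum>i. hausdorff_cost s (B n i)) \<le> hausdorff_premeasure s \<delta> (A n) + e * (1/2)^Suc n"
    by metis
  define C where "C = case_prod B o prod_decode"
  have "(\<Union>n. A n) \<subseteq> (\<Union>i. C i)"
    using B1 by (auto simp add: C_def split_def subset_eq) (metis fst_conv snd_conv prod_encode_inverse)
  moreover have "\<And>i. bounded (C i) \<and> diameter (C i) \<le> \<delta>"
    using B2 by (auto simp: C_def split_def)
  ultimately have "hausdorff_premeasure s \<delta> (\<Union>n. A n) \<le> (\<Sum>i. hausdorff_cost s (C i))"
    unfolding hausdorff_premeasure_def by (intro INF_lower) auto
  also have "\<dots> = (\<Sum>i. \<Sum>j. hausdorff_cost s (B i j))"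
    unfolding C_def comp_def
    by (rule suminf_ennreal_2dimen[where f = "\<lambda>p. hausdorff_cost s (case_prod B p)"]) simp
  also have "\<dots> \<le> (\<Sum>n. hausdorff_premeasure s \<delta> (A n) + e * (1/2)^Suc n)"
    using B3 by (intro suminf_le) auto
  also have "\<dots> = (\<Sum>n. hausdorff_premeasure s \<delta> (A n)) + (\<Sum>n. ennreal e * ennreal ((1/2) ^ Suc n))"
    using \<open>0 < e\<close> by (subst suminf_add[symmetric])
      (auto simp del: ennreal_suminf_cmult simp add: ennreal_mult[symmetric])
  also have "\<dots> = (\<Sum>n. hausdorff_premeasure s \<delta> (A n)) + e"
    unfolding ennreal_suminf_cmult
    by (subst suminf_ennreal_eq[OF zero_le_power power_half_series]) auto
  finally show "hausdorff_premeasure s \<delta> (\<Union>n. A n) \<le> (\<Sum>n. hausdorff_premeasure s \<delta> (A n)) + e" .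
qed

lemma hausdorff_outer_space: "outer_measure_space UNIV (hausdorff_outer s)"
proof -
  have "hausdorff_outer s (\<Union>n. A n) \<le> (\<Sum>n. hausdorff_outer s (A n))"
    for A :: "nat \<Rightarrow> 'a set"
    unfolding hausdorff_outer_def[of s "\<Union>n. A n"]
  proof (rule SUP_least)
    fix \<delta> :: real assume "\<delta> \<in> {0<..}"
    then have "(\<Sum>n. hausdorff_premeasure s \<delta> (A n)) \<le> (\<Sum>n. hausdorff_outer s (A n))"
      by (intro suminf_le) (auto simp: hausdorff_outer_def intro: SUP_upper)
    then show "hausdorff_premeasure s \<delta> (\<Union>n. A n) \<le> (\<Sum>n. hausdorff_outer s (A n))"
      using hausdorff_premeasure_subadditive order_trans by blast
  qed
  moreover have "hausdorff_outer s ({}::'a set) = 0"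
    by (simp add: hausdorff_outer_def hausdorff_premeasure_empty)
  moreover have "hausdorff_outer s A \<le> hausdorff_outer s B" if "A \<subseteq> B" for A B :: "'a set"
    unfolding hausdorff_outer_def using hausdorff_premeasure_mono[OF that] by (intro SUP_mono) auto
  ultimately show ?thesis
    by (auto simp: outer_measure_space_def positive_def increasing_def countably_subadditive_def)
qed

lemma hausdorff_outer_mono: "A \<subseteq> B \<Longrightarrow> hausdorff_outer s A \<le> hausdorff_outer s B"
  using hausdorff_outer_space[of s] by (auto simp: outer_measure_space_def increasing_def)

lemma hausdorff_outer_empty: "hausdorff_outer s {} = 0"
  using hausdorff_outer_space[of s] by (auto simp: outer_measure_space_def positive_def)

lemma hausdorff_outer_subadditive:
  "hausdorff_outer s (\<Union>n. A n) \<le> (\<Sum>n. hausdorff_outer s (A n :: 'a::metric_space set))"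
  unfolding hausdorff_outer_def[of s "\<Union>n. A n"]
proof (rule SUP_least)
  fix \<delta> :: real assume "\<delta> \<in> {0<..}"
  then have "(\<Sum>n. hausdorff_premeasure s \<delta> (A n)) \<le> (\<Sum>n. hausdorff_outer s (A n))"
    by (intro suminf_le) (auto simp: hausdorff_outer_def intro: SUP_upper)
  then show "hausdorff_premeasure s \<delta> (\<Union>n. A n) \<le> (\<Sum>n. hausdorff_outer s (A n))"
    using hausdorff_premeasure_subadditive order_trans by blast
qed

lemma hausdorff_outer_Un: "hausdorff_outer s (A \<union> B) \<le> hausdorff_outer s A + hausdorff_outer s B"
proof -
  have "hausdorff_outer s (\<Union>n. binaryset A B n) \<le> (\<Sum>n. hausdorff_outer s (binaryset A B n))"
    by (rule hausdorff_outer_subadditive)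
  then show ?thesis
    by (simp add: UN_binaryset_eq suminf_binaryset_eq hausdorff_outer_empty)
qed

lemma hausdorff_measure_space:
  "measure_space UNIV (lambda_system UNIV UNIV (hausdorff_outer s)) (hausdorff_outer s)"
proof -
  interpret sigma_algebra UNIV "UNIV :: 'a set set"
    using sigma_algebra_Pow[of "UNIV :: 'a set"] by simp
  show ?thesis by (rule caratheodory_lemma[OF hausdorff_outer_space])
qed

lemma space_hausdorff_measure: "space (hausdorff_measure s) = UNIV"
  by (simp add: hausdorff_measure_def space_measure_of_conv)

lemma sets_hausdorff_measure:
  "sets (hausdorff_measure s) = lambda_system UNIV UNIV (hausdorff_outer s)"
  unfolding hausdorff_measure_def
  by (intro sigma_algebra.sets_measure_of_eq
      hausdorff_measure_space[unfolded measure_space_def, THEN conjunct1])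

lemma emeasure_hausdorff_measure:
  "A \<in> sets (hausdorff_measure s) \<Longrightarrow> emeasure (hausdorff_measure s) A = hausdorff_outer s A"
  using hausdorff_measure_space[of s] unfolding sets_hausdorff_measure
  unfolding hausdorff_measure_def
  by (intro emeasure_measure_of_sigma) (auto simp: measure_space_def)

lemma hausdorff_premeasure_separated:
  fixes A B :: "'a::metric_space set"
  assumes sep: "\<And>x y. x \<in> A \<Longrightarrow> y \<in> B \<Longrightarrow> \<delta> < dist x y" and "\<delta> > 0"
  shows "hausdorff_premeasure s \<delta> A + hausdorff_premeasure s \<delta> B \<le> hausdorff_premeasure s \<delta> (A \<union> B)"
  unfolding hausdorff_premeasure_def[of s \<delta> "A \<union> B"]
proof (rule INF_greatest)
  fix C :: "nat \<Rightarrow> 'a set"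
  assume "C \<in> {C. A \<union> B \<subseteq> (\<Union>i. C i) \<and> (\<forall>i. bounded (C i) \<and> diameter (C i) \<le> \<delta>)}"
  then have C: "A \<union> B \<subseteq> (\<Union>i. C i)" "\<And>i. bounded (C i)" "\<And>i. diameter (C i) \<le> \<delta>" by auto
  define P where "P i = (if C i \<inter> A = {} then {} else C i)" for i
  define Q where "Q i = (if C i \<inter> B = {} then {} else C i)" for i
  have disj: "C i \<inter> A = {} \<or> C i \<inter> B = {}" for i
  proof (rule ccontr)
    assume "\<not> ?thesis"
    then obtain x y where "x \<in> C i" "x \<in> A" "y \<in> C i" "y \<in> B" by auto
    then show False
      using sep diameter_bounded_bound[OF C(2)[of i], of x y] C(3)[of i] by force
  qed
  have covP: "A \<subseteq> (\<Union>i. P i)"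
  proof
    fix x assume "x \<in> A"
    then obtain i where "x \<in> C i" using C(1) by auto
    with \<open>x \<in> A\<close> have "x \<in> P i" by (auto simp: P_def)
    then show "x \<in> (\<Union>i. P i)" by blast
  qed
  have covQ: "B \<subseteq> (\<Union>i. Q i)"
  proof
    fix x assume "x \<in> B"
    then obtain i where "x \<in> C i" using C(1) by auto
    with \<open>x \<in> B\<close> have "x \<in> Q i" by (auto simp: Q_def)
    then show "x \<in> (\<Union>i. Q i)" by blast
  qed
  have "hausdorff_premeasure s \<delta> A \<le> (\<Sum>i. hausdorff_cost s (P i))"
    unfolding hausdorff_premeasure_def
    using C(2,3) \<open>\<delta> > 0\<close> covP by (intro INF_lower) (auto simp: P_def)
  moreover have "hausdorff_premeasure s \<delta> B \<le> (\<Sum>i. hausdorff_cost s (Q i))"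
    unfolding hausdorff_premeasure_def
    using C(2,3) \<open>\<delta> > 0\<close> covQ by (intro INF_lower) (auto simp: Q_def)
  ultimately have "hausdorff_premeasure s \<delta> A + hausdorff_premeasure s \<delta> B \<le>
      (\<Sum>i. hausdorff_cost s (P i)) + (\<Sum>i. hausdorff_cost s (Q i))"
    by (rule add_mono)
  also have "\<dots> = (\<Sum>i. hausdorff_cost s (P i) + hausdorff_cost s (Q i))"
    by (rule suminf_add) auto
  also have "\<dots> \<le> (\<Sum>i. hausdorff_cost s (C i))"
    using disj by (intro suminf_le) (auto simp: P_def Q_def hausdorff_cost_def)
  finally show "hausdorff_premeasure s \<delta> A + hausdorff_premeasure s \<delta> B \<le> (\<Sum>i. hausdorff_cost s (C i))" .
qed

lemma hausdorff_outer_separated: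
  fixes A B :: "'a::metric_space set"
  assumes sep: "\<And>x y. x \<in> A \<Longrightarrow> y \<in> B \<Longrightarrow> e \<le> dist x y" and "e > 0"
  shows "hausdorff_outer s A + hausdorff_outer s B \<le> hausdorff_outer s (A \<union> B)"
proof -
  have 1: "hausdorff_premeasure s \<delta> A + hausdorff_premeasure s \<eta> B \<le> hausdorff_outer s (A \<union> B)"
    if "\<delta> > 0" "\<eta> > 0" for \<delta> \<eta>
  proof -
    define \<rho> where "\<rho> = min (min \<delta> \<eta>) (e/2)"
    have "\<rho> > 0" "\<rho> \<le> \<delta>" "\<rho> \<le> \<eta>" "\<rho> < e" using that \<open>e > 0\<close> by (auto simp: \<rho>_def)
    have "hausdorff_premeasure s \<delta> A + hausdorff_premeasure s \<eta> B \<le>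
        hausdorff_premeasure s \<rho> A + hausdorff_premeasure s \<rho> B"
      using \<open>\<rho> \<le> \<delta>\<close> \<open>\<rho> \<le> \<eta>\<close> by (intro add_mono hausdorff_premeasure_antimono)
    also have "\<dots> \<le> hausdorff_premeasure s \<rho> (A \<union> B)"
      using sep \<open>\<rho> < e\<close> \<open>\<rho> > 0\<close> by (intro hausdorff_premeasure_separated) force+
    also have "\<dots> \<le> hausdorff_outer s (A \<union> B)"
      unfolding hausdorff_outer_def using \<open>\<rho> > 0\<close> by (intro SUP_upper) auto
    finally show ?thesis .
  qed
  have ne: "{0::real<..} \<noteq> {}" by (auto intro: exI[of _ 1])
  have 2: "hausdorff_premeasure s \<delta> A + hausdorff_outer s B \<le> hausdorff_outer s (A \<union> B)" if "\<delta> > 0" for \<delta>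
    unfolding hausdorff_outer_def[of s B]
    by (subst ennreal_SUP_add_right[OF ne]) (auto intro!: SUP_least 1 that)
  show ?thesis
    unfolding hausdorff_outer_def[of s A]
    by (subst ennreal_SUP_add_left[OF ne, symmetric]) (auto intro!: SUP_least 2)
qed

lemma hausdorff_outer_separated_sum:
  fixes A :: "nat \<Rightarrow> 'a::metric_space set"
  assumes sep: "\<And>n. \<exists>e>0. \<forall>m<n. \<forall>x\<in>A m. \<forall>y\<in>A n. e \<le> dist x y"
  shows "(\<Sum>i<n. hausdorff_outer s (A i)) \<le> hausdorff_outer s (\<Union>i<n. A i)"
proof (induction n)
  case (Suc n)
  obtain e where e: "e > 0" "\<And>m x y. m < n \<Longrightarrow> x \<in> A m \<Longrightarrow> y \<in> A n \<Longrightarrow> e \<le> dist x y"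
    using sep[of n] by blast
  have "(\<Sum>i<Suc n. hausdorff_outer s (A i)) \<le> hausdorff_outer s (\<Union>i<n. A i) + hausdorff_outer s (A n)"
    using Suc by (simp add: add_right_mono)
  also have "\<dots> \<le> hausdorff_outer s ((\<Union>i<n. A i) \<union> A n)"
    using e by (intro hausdorff_outer_separated[where e = e]) auto
  also have "(\<Union>i<n. A i) \<union> A n = (\<Union>i<Suc n. A i)" by (auto simp: less_Suc_eq)
  finally show ?case .
qed simp

lemma closed_in_hausdorff_sets:
  fixes F :: "'a::metric_space set"
  assumes "closed F"
  shows "F \<in> sets (hausdorff_measure s)"
proof (cases "F = {}")
  case False
  let ?H = "hausdorff_outer s :: 'a set \<Rightarrow> ennreal"
  have main: "?H (A \<inter> F) + ?H (A - F) \<le> ?H A" if fin: "?H A < top" for A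
  proof -
    define S where "S n = {x \<in> A. 1 / real (Suc n) \<le> infdist x F}" for n
    define R where "R n = {x \<in> A. 1 / real (Suc (Suc n)) \<le> infdist x F \<and> infdist x F < 1 / real (Suc n)}" for n
    have Rsep: "\<exists>e>0. \<forall>m x y. m + 2 \<le> n \<longrightarrow> x \<in> R m \<longrightarrow> y \<in> R n \<longrightarrow> e \<le> dist x y" for n
    proof (cases n)
      case 0
      then show ?thesis by (auto intro!: exI[of _ 1])
    next
      case (Suc n')
      have "1 / real (Suc n') - 1 / real (Suc n) \<le> dist x y"
        if "m + 2 \<le> n" "x \<in> R m" "y \<in> R n" for m x y
      proof -
        have "1 / real (Suc n') \<le> 1 / real (Suc (Suc m))"
          using that Suc by (intro divide_left_mono) auto
        then have "1 / real (Suc n') \<le> infdist x F" using that by (auto simp: R_def)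
        moreover have "infdist y F < 1 / real (Suc n)" using that by (auto simp: R_def)
        moreover have "infdist x F \<le> infdist y F + dist x y" by (rule infdist_triangle)
        ultimately show ?thesis by linarith
      qed
      moreover have "1 / real (Suc n') - 1 / real (Suc n) > 0"
        using Suc by (simp add: divide_simps)
      ultimately show ?thesis by blast
    qed
    have par: "(\<Sum>i<N. ?H (R (2 * i + c))) \<le> ?H A" for N c
    proof -
      have "\<exists>e>0. \<forall>m<n. \<forall>x\<in>R (2 * m + c). \<forall>y\<in>R (2 * n + c). e \<le> dist x y" for n
      proof -
        obtain e where "e > 0"
          "\<And>m x y. m + 2 \<le> 2 * n + c \<Longrightarrow> x \<in> R m \<Longrightarrow> y \<in> R (2 * n + c) \<Longrightarrow> e \<le> dist x y"
          using Rsep[of "2 * n + c"] by blast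
        note e = this
        have "e \<le> dist x y" if "m < n" "x \<in> R (2 * m + c)" "y \<in> R (2 * n + c)" for m x y
          using that by (intro e(2)[of "2 * m + c"]) auto
        with e(1) show ?thesis by blast
      qed
      then have "(\<Sum>i<N. ?H (R (2 * i + c))) \<le> ?H (\<Union>i<N. R (2 * i + c))"
        by (rule hausdorff_outer_separated_sum)
      also have "\<dots> \<le> ?H A" by (intro hausdorff_outer_mono) (auto simp: R_def)
      finally show ?thesis .
    qed
    have twoN: "(\<Sum>i<2 * N. ?H (R i)) = (\<Sum>i<N. ?H (R (2 * i + 0))) + (\<Sum>i<N. ?H (R (2 * i + 1)))" for N
      by (induction N) (auto simp: algebra_simps)
    have "(\<Sum>i. ?H (R i)) \<le> ?H A + ?H A"
    proof (rule suminf_le_const[OF summableI])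
      fix n
      have "(\<Sum>i<n. ?H (R i)) \<le> (\<Sum>i<2 * n. ?H (R i))" by (rule sum_mono2) auto
      also have "\<dots> \<le> ?H A + ?H A" unfolding twoN by (intro add_mono par)
      finally show "(\<Sum>i<n. ?H (R i)) \<le> ?H A + ?H A" .
    qed
    also have "\<dots> < top" using fin by simp
    finally have finsum: "(\<Sum>i. ?H (R i)) < top" .
    have tail: "(\<lambda>n. (\<Sum>i. ?H (R (i + n)))) \<longlonglongrightarrow> 0"
    proof -
      define r where "r i = enn2real (?H (R i))" for i
      have r: "r i \<ge> 0" "?H (R i) = ennreal (r i)" for i
        using ennreal_suminf_lessD[OF finsum, of i] by (auto simp: r_def)
      then have sr: "summable r"
        using finsum by (intro summable_suminf_not_top) auto
      have "(\<lambda>n. \<Sum>i. r (i + n)) \<longlonglongrightarrow> 0" by (rule suminf_exist_split2[OF sr])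
      then have "(\<lambda>n. ennreal (\<Sum>i. r (i + n))) \<longlonglongrightarrow> ennreal 0" by (rule tendsto_ennrealI)
      moreover have "(\<Sum>i. ?H (R (i + n))) = ennreal (\<Sum>i. r (i + n))" for n
        unfolding r using sr r(1) by (intro suminf_ennreal2) (auto simp: summable_iff_shift)
      ultimately show ?thesis by simp
    qed
    have step: "?H (A \<inter> F) + ?H (A - F) \<le> ?H A + (\<Sum>i. ?H (R (i + n)))" for n
    proof -
      have "A - F \<subseteq> S n \<union> (\<Union>i. R (i + n))"
      proof
        fix x assume x: "x \<in> A - F"
        then have pos: "infdist x F > 0"
          using assms False by (metis DiffD2 in_closed_iff_infdist_zero infdist_nonneg less_eq_real_def)
        show "x \<in> S n \<union> (\<Union>i. R (i + n))"
        proof (cases "1 / real (Suc n) \<le> infdist x F")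
          case False
          obtain N where N: "1 / real (Suc N) \<le> infdist x F"
            using pos by (metis nat_approx_posE less_imp_le)
          define M where "M = (LEAST m. 1 / real (Suc m) \<le> infdist x F)"
          have M: "1 / real (Suc M) \<le> infdist x F" unfolding M_def using LeastI[where P = "\<lambda>m. 1 / real (Suc m) \<le> infdist x F", OF N] by simp
          have "M > n"
          proof (rule ccontr)
            assume "\<not> M > n"
            then have "1 / real (Suc n) \<le> 1 / real (Suc M)" by (intro divide_left_mono) auto
            with M False show False by linarith
          qed
          then obtain M' where M': "M = Suc M'" by (cases M) auto
          have "\<not> 1 / real (Suc M') \<le> infdist x F"
            using not_less_Least[of M' "\<lambda>m. 1 / real (Suc m) \<le> infdist x F"] M' lessI[of M']
            unfolding M_def[symmetric] by metis
          then have "x \<in> R M'" using M x by (auto simp: R_def M')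
          moreover have "M' = (M' - n) + n" using \<open>M > n\<close> M' by simp
          ultimately show ?thesis by (metis UN_I UNIV_I UnI2)
        qed (use x in \<open>auto simp: S_def\<close>)
      qed
      then have "?H (A - F) \<le> ?H (S n) + ?H (\<Union>i. R (i + n))"
        by (meson hausdorff_outer_mono hausdorff_outer_Un order_trans)
      also have "\<dots> \<le> ?H (S n) + (\<Sum>i. ?H (R (i + n)))"
        by (intro add_left_mono hausdorff_outer_subadditive)
      finally have "?H (A \<inter> F) + ?H (A - F) \<le> (?H (A \<inter> F) + ?H (S n)) + (\<Sum>i. ?H (R (i + n)))"
        by (simp add: add.assoc add_left_mono)
      also have "?H (A \<inter> F) + ?H (S n) \<le> ?H (A \<inter> F \<union> S n)"
      proof (rule hausdorff_outer_separated[where e = "1 / real (Suc n)"])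
        fix x y assume "x \<in> A \<inter> F" "y \<in> S n"
        then show "1 / real (Suc n) \<le> dist x y"
          using infdist_le[of x F y] by (auto simp: S_def dist_commute)
      qed simp
      also have "\<dots> \<le> ?H A" by (intro hausdorff_outer_mono) (auto simp: S_def)
      finally show ?thesis by (simp add: add_right_mono)
    qed
    have "(\<lambda>n. ?H A + (\<Sum>i. ?H (R (i + n)))) \<longlonglongrightarrow> ?H A + 0"
      by (intro tendsto_add tail tendsto_const)
    from LIMSEQ_le_const[OF this] step show ?thesis by auto
  qed
  have "?H (F \<inter> A) + ?H ((UNIV - F) \<inter> A) = ?H A" for A
  proof (rule antisym)
    have "?H (F \<inter> A) + ?H ((UNIV - F) \<inter> A) = ?H (A \<inter> F) + ?H (A - F)"
      by (simp add: Int_commute Diff_eq)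
    also have "\<dots> \<le> ?H A"
      using main[of A] by (cases "?H A < top") (auto simp: less_top[symmetric])
    finally show "?H (F \<inter> A) + ?H ((UNIV - F) \<inter> A) \<le> ?H A" .
    have "A = (F \<inter> A) \<union> ((UNIV - F) \<inter> A)" by auto
    then show "?H A \<le> ?H (F \<inter> A) + ?H ((UNIV - F) \<inter> A)"
      using hausdorff_outer_Un[of s "F \<inter> A" "(UNIV - F) \<inter> A"] by simp
  qed
  then show ?thesis by (simp add: sets_hausdorff_measure lambda_system_def)
qed auto

lemma borel_subset_hausdorff_sets:
  "sets (borel :: 'a::metric_space measure) \<subseteq> sets (hausdorff_measure s)"
proof -
  have "sigma_sets (space (hausdorff_measure s)) (Collect closed) \<subseteq> sets (hausdorff_measure s :: 'a measure)"
    using closed_in_hausdorff_sets by (intro sets.sigma_sets_subset) auto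
  then show ?thesis
    by (simp add: borel_eq_closed space_hausdorff_measure)
qed


section \<open>Domains and traces\<close>

text \<open>Near each boundary point the domain is, in suitable Cartesian coordinates, the strict
  subgraph of a Lipschitz function; \<open>e\<close> is the last coordinate direction and \<open>\<phi>\<close> is a function on
  the hyperplane orthogonal to \<open>e\<close>.\<close>

definition lipschitz_domain :: "'a::euclidean_space set \<Rightarrow> bool" where
  "lipschitz_domain \<Omega> \<longleftrightarrow> open \<Omega> \<and> connected \<Omega> \<and>
     (\<forall>x\<in>frontier \<Omega>. \<exists>e r L \<phi>. norm e = 1 \<and> r > 0 \<and> L-lipschitz_on {y. y \<bullet> e = 0} \<phi> \<and>
        \<Omega> \<inter> ball x r = {y \<in> ball x r. y \<bullet> e < \<phi> (y - (y \<bullet> e) *\<^sub>R e)})"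

definition polyhedral_domain :: "'a::euclidean_space set \<Rightarrow> bool" where
  "polyhedral_domain D \<longleftrightarrow> connected D \<and>
     (\<exists>\<P>. finite \<P> \<and> (\<forall>P\<in>\<P>. polytope P) \<and> D = interior (\<Union>\<P>))"

text \<open>\<open>n\<close> is the outward unit normal at \<open>x\<close> if, to first order at \<open>x\<close>, the domain is the half-space
  on the side of \<open>-n\<close>. For a Lipschitz domain this means that the local graph function is
  differentiable at the point, which is the case almost everywhere on the boundary.\<close>

definition is_outer_normal :: "'a::euclidean_space set \<Rightarrow> 'a \<Rightarrow> 'a \<Rightarrow> bool" where
  "is_outer_normal \<Omega> x n \<longleftrightarrow> norm n = 1 \<and>
     (\<forall>\<epsilon>>0. \<exists>r>0. \<forall>y\<in>ball x r.
        (n \<bullet> (y - x) < - \<epsilon> * norm (y - x) \<longrightarrow> y \<in> \<Omega>) \<and>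
        (n \<bullet> (y - x) > \<epsilon> * norm (y - x) \<longrightarrow> y \<notin> \<Omega>))"

definition outer_normal :: "'a::euclidean_space set \<Rightarrow> 'a \<Rightarrow> 'a" where
  "outer_normal \<Omega> x = (if \<exists>n. is_outer_normal \<Omega> x n then THE n. is_outer_normal \<Omega> x n else 0)"

definition gradient :: "('a::euclidean_space \<Rightarrow> real) \<Rightarrow> 'a \<Rightarrow> 'a" where
  "gradient u x = (if u differentiable (at x) then THE D. GDERIV u x :> D else 0)"

text \<open>The gradient of a finite element function jumps across faces, and part of the boundary of
  \<open>\<Omega>\<close> may lie in a face. Hence \<open>\<nabla>u\<close> on the boundary is the trace taken from inside \<open>\<Omega>\<close>.\<close>

definition trace_gradient :: "'a::euclidean_space set \<Rightarrow> ('a \<Rightarrow> real) \<Rightarrow> 'a \<Rightarrow> 'a" where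
  "trace_gradient \<Omega> u x = Lim (at_right 0) (\<lambda>t. gradient u (x - t *\<^sub>R outer_normal \<Omega> x))"

definition normal_flux :: "'a::euclidean_space set \<Rightarrow> ('a \<Rightarrow> real) \<Rightarrow> 'a \<Rightarrow> real" where
  "normal_flux \<Omega> u x = outer_normal \<Omega> x \<bullet> trace_gradient \<Omega> u x"

definition L2_inner :: "'a measure \<Rightarrow> 'a set \<Rightarrow> ('a \<Rightarrow> 'b::real_inner) \<Rightarrow> ('a \<Rightarrow> 'b) \<Rightarrow> real" where
  "L2_inner M S u v = (LINT x:S|M. u x \<bullet> v x)"

abbreviation surface_measure :: "(real ^ 'd) measure" where
  "surface_measure \<equiv> hausdorff_measure (CARD('d) - 1)"


section \<open>Meshes\<close>

definition simplicial_mesh :: "(real ^ 'd) set \<Rightarrow> (real ^ 'd) set set \<Rightarrow> bool" where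
  "simplicial_mesh D \<T> \<longleftrightarrow>
     triangulation \<T> \<and> (\<forall>T\<in>\<T>. int CARD('d) simplex T) \<and> \<Union>\<T> = closure D"

definition inball_diameter :: "'a::euclidean_space set \<Rightarrow> real" where
  "inball_diameter T = Sup {2 * r | r. r > 0 \<and> (\<exists>x. cball x r \<subseteq> T)}"

definition shape_regular :: "real \<Rightarrow> (real ^ 'd) set set \<Rightarrow> bool" where
  "shape_regular \<sigma> \<T> \<longleftrightarrow> (\<forall>T\<in>\<T>. diameter T \<le> \<sigma> * inball_diameter T)"

text \<open>\<open>\<T>\<close> below is always the background mesh (of the larger polyhedral domain).\<close>

definition active_mesh :: "(real ^ 'd) set \<Rightarrow> (real ^ 'd) set set \<Rightarrow> (real ^ 'd) set set" where
  "active_mesh \<Omega> \<T> = {T \<in> \<T>. emeasure surface_measure (T \<inter> \<Omega>) > 0}"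

definition active_domain :: "(real ^ 'd) set \<Rightarrow> (real ^ 'd) set set \<Rightarrow> (real ^ 'd) set" where
  "active_domain \<Omega> \<T> = \<Union>(active_mesh \<Omega> \<T>)"

definition cut_mesh :: "(real ^ 'd) set \<Rightarrow> (real ^ 'd) set set \<Rightarrow> (real ^ 'd) set set" where
  "cut_mesh \<Omega> \<T> = {T \<in> active_mesh \<Omega> \<T>. T \<inter> frontier \<Omega> \<noteq> {}}"

definition boundary_resolved :: "(real ^ 'd) set \<Rightarrow> (real ^ 'd) set set \<Rightarrow> bool" where
  "boundary_resolved \<Omega> \<T> \<longleftrightarrow>
     cut_mesh \<Omega> \<T> = {T \<in> active_mesh \<Omega> \<T>. T \<inter> frontier (active_domain \<Omega> \<T>) \<noteq> {}}"

definition ghost_faces :: "(real ^ 'd) set \<Rightarrow> (real ^ 'd) set set \<Rightarrow> (real ^ 'd) set set" where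
  "ghost_faces \<Omega> \<T> =
     {F. (\<exists>T\<in>cut_mesh \<Omega> \<T>. F facet_of T) \<and> \<not> F \<subseteq> frontier (active_domain \<Omega> \<T>)}"


section \<open>Finite element spaces\<close>

definition polys :: "nat \<Rightarrow> (real ^ 'd \<Rightarrow> real) set" where
  "polys k = {p. \<exists>c :: ('d \<Rightarrow> nat) \<Rightarrow> real. \<forall>x.
     p x = (\<Sum>\<alpha> | (\<Sum>i\<in>UNIV. \<alpha> i) \<le> k. c \<alpha> * (\<Prod>i\<in>UNIV. (x $ i) ^ \<alpha> i))}"

text \<open>A function on the active domain is represented by its extension by zero.\<close>

definition fe_space :: "(real ^ 'd) set \<Rightarrow> (real ^ 'd) set set \<Rightarrow> nat \<Rightarrow> (real ^ 'd \<Rightarrow> real) set" where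
  "fe_space \<Omega> \<T> k = {v. continuous_on (active_domain \<Omega> \<T>) v \<and>
     (\<forall>T\<in>active_mesh \<Omega> \<T>. \<exists>p\<in>polys k. \<forall>x\<in>T. v x = p x) \<and>
     (\<forall>x. x \<notin> active_domain \<Omega> \<T> \<longrightarrow> v x = 0)}"

definition fe_space0 :: "(real ^ 'd) set \<Rightarrow> (real ^ 'd) set set \<Rightarrow> nat \<Rightarrow> (real ^ 'd \<Rightarrow> real) set" where
  "fe_space0 \<Omega> \<T> k = {v \<in> fe_space \<Omega> \<T> k. \<forall>x\<in>frontier (active_domain \<Omega> \<T>). v x = 0}"

definition cell_poly :: "nat \<Rightarrow> (real ^ 'd \<Rightarrow> real) \<Rightarrow> (real ^ 'd) set \<Rightarrow> real ^ 'd \<Rightarrow> real" where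
  "cell_poly k u T = (THE p. p \<in> polys k \<and> (\<forall>x\<in>T. u x = p x))"

definition directional_deriv :: "nat \<Rightarrow> 'a::real_normed_vector \<Rightarrow> ('a \<Rightarrow> real) \<Rightarrow> 'a \<Rightarrow> real" where
  "directional_deriv l n p x = (deriv ^^ l) (\<lambda>t. p (x + t *\<^sub>R n)) 0"

text \<open>The orientation of the normal and the order of the two adjacent cells are arbitrary: either
  choice only affects the sign of a jump, and only products of two jumps across the same face are
  used.\<close>

definition face_normal :: "'a::euclidean_space set \<Rightarrow> 'a" where
  "face_normal F = (SOME n. norm n = 1 \<and> (\<forall>x\<in>F. \<forall>y\<in>F. n \<bullet> (x - y) = 0))"

definition face_cells :: "(real ^ 'd) set \<Rightarrow> (real ^ 'd) set set \<Rightarrow> (real ^ 'd) set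
    \<Rightarrow> (real ^ 'd) set \<times> (real ^ 'd) set" where
  "face_cells \<Omega> \<T> F = (SOME (T1, T2). T1 \<in> active_mesh \<Omega> \<T> \<and> T2 \<in> active_mesh \<Omega> \<T> \<and>
     T1 \<noteq> T2 \<and> F facet_of T1 \<and> F facet_of T2)"

definition normal_jump :: "(real ^ 'd) set \<Rightarrow> (real ^ 'd) set set \<Rightarrow> nat \<Rightarrow> (real ^ 'd) set \<Rightarrow> nat
    \<Rightarrow> (real ^ 'd \<Rightarrow> real) \<Rightarrow> real ^ 'd \<Rightarrow> real" where
  "normal_jump \<Omega> \<T> k F l u x =
     (case face_cells \<Omega> \<T> F of (T1, T2) \<Rightarrow>
        directional_deriv l (face_normal F) (cell_poly k u T1) x -
        directional_deriv l (face_normal F) (cell_poly k u T2) x)"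


section \<open>Bilinear forms and operators\<close>

definition weighted_boundary_form :: "(real ^ 'd) set \<Rightarrow> (real ^ 'd) set set
    \<Rightarrow> (real ^ 'd \<Rightarrow> real) \<Rightarrow> (real ^ 'd \<Rightarrow> real) \<Rightarrow> real" where
  "weighted_boundary_form \<Omega> \<T> u v =
     (\<Sum>T\<in>cut_mesh \<Omega> \<T>. inverse (diameter T) * L2_inner surface_measure (T \<inter> frontier \<Omega>) u v)"

definition ghost_penalty :: "(real ^ 'd) set \<Rightarrow> (real ^ 'd) set set \<Rightarrow> nat
    \<Rightarrow> (real ^ 'd \<Rightarrow> real) \<Rightarrow> (real ^ 'd \<Rightarrow> real) \<Rightarrow> real" where
  "ghost_penalty \<Omega> \<T> k u v =
     (\<Sum>l=1..k. \<Sum>F\<in>ghost_faces \<Omega> \<T>. diameter F ^ (2 * l - 1) *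
        L2_inner surface_measure F (normal_jump \<Omega> \<T> k F l u) (normal_jump \<Omega> \<T> k F l v))"

definition cutfem_form :: "(real ^ 'd) set \<Rightarrow> (real ^ 'd) set set \<Rightarrow> nat \<Rightarrow> real \<Rightarrow> real
    \<Rightarrow> (real ^ 'd \<Rightarrow> real) \<Rightarrow> (real ^ 'd \<Rightarrow> real) \<Rightarrow> real" where
  "cutfem_form \<Omega> \<T> k \<gamma> \<beta> u v =
     L2_inner lebesgue \<Omega> (gradient u) (gradient v)
     - L2_inner surface_measure (frontier \<Omega>) (normal_flux \<Omega> u) v
     - L2_inner surface_measure (frontier \<Omega>) u (normal_flux \<Omega> v)
     + \<gamma> * weighted_boundary_form \<Omega> \<T> u v
     + \<beta> * ghost_penalty \<Omega> \<T> k u v"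

definition dirichlet_form :: "(real ^ 'd) set \<Rightarrow> (real ^ 'd) set set
    \<Rightarrow> (real ^ 'd \<Rightarrow> real) \<Rightarrow> (real ^ 'd \<Rightarrow> real) \<Rightarrow> real" where
  "dirichlet_form \<Omega> \<T> u v = L2_inner lebesgue (active_domain \<Omega> \<T>) (gradient u) (gradient v)"

definition norm_b_squared :: "(real ^ 'd) set \<Rightarrow> (real ^ 'd) set set \<Rightarrow> real
    \<Rightarrow> (real ^ 'd \<Rightarrow> real) \<Rightarrow> real" where
  "norm_b_squared \<Omega> \<T> \<gamma> v = dirichlet_form \<Omega> \<T> v v + \<gamma> * weighted_boundary_form \<Omega> \<T> v v"

text \<open>\<open>A\<close> is the operator on \<open>V\<close> representing the bilinear form \<open>a\<close> in the \<open>L\<^sup>2(S)\<close> inner product.\<close>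

definition represents_form :: "'a::euclidean_space set \<Rightarrow> ('a \<Rightarrow> real) set
    \<Rightarrow> (('a \<Rightarrow> real) \<Rightarrow> ('a \<Rightarrow> real) \<Rightarrow> real) \<Rightarrow> (('a \<Rightarrow> real) \<Rightarrow> ('a \<Rightarrow> real)) \<Rightarrow> bool" where
  "represents_form S V a A \<longleftrightarrow>
     (\<forall>u\<in>V. A u \<in> V \<and> (\<forall>v\<in>V. L2_inner lebesgue S (A u) v = a u v))"

end

theory Submission
  imports Defs "HOL-Computational_Algebra.Polynomial"
begin

text \<open>Since \<open>a\<^sub>h\<close> is equivalent to \<open>\<parallel>\<nabla>u\<parallel>\<^sup>2 + \<gamma> (h\<^sup>-\<^sup>1 u, u)\<^sub>\<Gamma>\<close>, only the boundary term has to be bounded by the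
  Dirichlet form. A cut cell \<open>T\<close> meets \<open>\<partial>\<Omega>\<^sub>h\<close>, so \<open>u\<close> vanishes somewhere in \<open>T\<close> and \<open>\<bar>u\<bar> \<le> h\<^sub>T sup \<bar>\<nabla>u\<bar>\<close> on
  \<open>T\<close>. Lagrange extrapolation along segments, with nodes on the far half of each segment, and averaging
  over \<open>T\<close> give \<open>sup \<bar>\<nabla>u\<bar>\<^sup>2 \<le> C \<bar>T\<bar>\<^sup>-\<^sup>1 \<integral> \<bar>\<nabla>u\<bar>\<^sup>2\<close> with \<open>C\<close> depending on \<open>k\<close> and \<open>d\<close> only. Shape regularity bounds
  \<open>\<bar>T\<bar>\<close> below by \<open>c h\<^sub>T\<^sup>d\<close>, the finitely many Lipschitz charts of the compact set \<open>\<Gamma>\<close> bound the measure of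
  \<open>T \<inter> \<Gamma>\<close> above by \<open>C h\<^sub>T\<^sup>d\<^sup>-\<^sup>1\<close>, and all powers of \<open>h\<^sub>T\<close> cancel.\<close>

section \<open>Polynomials on convex bodies\<close>

text \<open>The weights are the values at \<open>s\<close> of the Lagrange basis polynomials of the
  nodes, so one \<open>w\<close> serves every \<open>Q\<close>. The identity holds because the
  interpolant \<open>R\<close> has degree at most \<open>k\<close> and agrees with \<open>Q\<close>
  at \<open>k + 1\<close> distinct nodes.\<close>

lemma lagrange_extrapolation:
  fixes t :: "nat \<Rightarrow> real"
  assumes inj: "inj_on t {..k}"
  shows "\<exists>w. \<forall>Q. degree Q \<le> k \<longrightarrow> poly Q s = (\<Sum>j\<le>k. w j * poly Q (t j))"
proof -
  define L where "L j = (\<Prod>i\<in>{..k} - {j}. smult (1 / (t j - t i)) [:- t i, 1:])" for j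
  have degL: "degree (L j) \<le> k" if "j \<le> k" for j
  proof -
    have "degree (L j) \<le> (\<Sum>i\<in>{..k} - {j}. degree (smult (1 / (t j - t i)) [:- t i, 1:]))"
      unfolding L_def using degree_prod_sum_le[of "{..k} - {j}" "\<lambda>i. smult (1 / (t j - t i)) [:- t i, 1:]"]
      unfolding comp_def by blast
    also have "\<dots> \<le> (\<Sum>i\<in>{..k} - {j}. 1)" by (intro sum_mono) (auto intro: order_trans[OF degree_smult_le])
    finally show ?thesis using that by simp
  qed
  have L: "poly (L j) (t i) = (if i = j then 1 else 0)" if "j \<le> k" "i \<le> k" for i j
  proof (cases "i = j")
    case True
    have "poly (L j) (t j) = (\<Prod>i\<in>{..k} - {j}. 1)"
      unfolding L_def poly_prod using that inj
      by (intro prod.cong) (auto simp: inj_on_def diff_divide_distrib[symmetric])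
    then show ?thesis using True by simp
  next
    case False
    then show ?thesis using that by (auto simp: L_def poly_prod)
  qed
  have "poly Q s = (\<Sum>j\<le>k. poly (L j) s * poly Q (t j))" if "degree Q \<le> k" for Q
  proof -
    define R where "R = (\<Sum>j\<le>k. smult (poly Q (t j)) (L j))"
    have "degree R \<le> k"
      unfolding R_def by (intro degree_sum_le) (auto intro: order_trans[OF degree_smult_le] degL)
    moreover have "poly R (t i) = poly Q (t i)" if "i \<le> k" for i
    proof -
      have "poly R (t i) = (\<Sum>j\<le>k. if i = j then poly Q (t j) else 0)"
        unfolding R_def poly_sum using that by (intro sum.cong) (auto simp: L)
      then show ?thesis using that by simp
    qed
    moreover have "card (t ` {..k}) = Suc k" using card_image[OF inj] by simp
    ultimately have "Q = R"
      using that by (intro poly_eqI_degree[of "t ` {..k}"]) auto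
    then have "poly Q s = poly R s" by simp
    then show ?thesis by (simp add: R_def poly_sum mult.commute)
  qed
  then show ?thesis by (intro exI[of _ "\<lambda>j. poly (L j) s"] allI impI)
qed

text \<open>Carries one-dimensional interpolation over to \<open>polys\<close>. On a line every
  coordinate is affine in the parameter, so a monomial becomes a product of affine factors whose
  number is its total degree.\<close>

lemma polys_along_line:
  assumes "p \<in> polys k"
  shows "\<exists>Q. degree Q \<le> k \<and> (\<forall>t. p (z + t *\<^sub>R v) = poly Q t)"
proof -
  obtain c where c: "\<And>x. p x = (\<Sum>\<alpha> | (\<Sum>i\<in>UNIV. \<alpha> i) \<le> k. c \<alpha> * (\<Prod>i\<in>UNIV. (x $ i) ^ \<alpha> i))"
    using assms unfolding polys_def by blast
  define q where "q \<alpha> = smult (c \<alpha>) (\<Prod>i\<in>UNIV. [:z $ i, v $ i:] ^ \<alpha> i)" for \<alpha>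
  have fin: "finite {\<alpha> :: 'a \<Rightarrow> nat. sum \<alpha> UNIV \<le> k}"
  proof (rule finite_subset)
    show "finite (UNIV \<rightarrow>\<^sub>E {..k} :: ('a \<Rightarrow> nat) set)" by (intro finite_PiE) auto
    show "{\<alpha>. sum \<alpha> UNIV \<le> k} \<subseteq> (UNIV \<rightarrow>\<^sub>E {..k} :: ('a \<Rightarrow> nat) set)"
    proof
      fix \<alpha> :: "'a \<Rightarrow> nat" assume *: "\<alpha> \<in> {\<alpha>. sum \<alpha> UNIV \<le> k}"
      have "\<alpha> i \<le> sum \<alpha> UNIV" for i by (intro member_le_sum) auto
      with * have "\<alpha> i \<le> k" for i using order_trans by blast
      then show "\<alpha> \<in> UNIV \<rightarrow>\<^sub>E {..k}" by auto
    qed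
  qed
  have "degree (q \<alpha>) \<le> k" if "sum \<alpha> UNIV \<le> k" for \<alpha>
  proof -
    have "degree (q \<alpha>) \<le> degree (\<Prod>i\<in>UNIV. [:z $ i, v $ i:] ^ \<alpha> i)"
      unfolding q_def by (rule degree_smult_le)
    also have "\<dots> \<le> (\<Sum>i\<in>UNIV. degree ([:z $ i, v $ i:] ^ \<alpha> i))"
      using degree_prod_sum_le[of UNIV "\<lambda>i. [:z $ i, v $ i:] ^ \<alpha> i"] by (simp add: comp_def)
    also have "\<dots> \<le> (\<Sum>i\<in>UNIV. \<alpha> i)"
    proof (rule sum_mono)
      fix i
      have "degree ([:z $ i, v $ i:] ^ \<alpha> i) \<le> degree [:z $ i, v $ i:] * \<alpha> i" by (rule degree_power_le)
      also have "\<dots> \<le> \<alpha> i" by simp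
      finally show "degree ([:z $ i, v $ i:] ^ \<alpha> i) \<le> \<alpha> i" .
    qed
    finally show ?thesis using that by simp
  qed
  then have "degree (\<Sum>\<alpha> | sum \<alpha> UNIV \<le> k. q \<alpha>) \<le> k"
    using fin by (intro degree_sum_le) auto
  moreover have "p (z + t *\<^sub>R v) = poly (\<Sum>\<alpha> | sum \<alpha> UNIV \<le> k. q \<alpha>) t" for t
    by (simp add: c q_def poly_sum poly_prod)
  ultimately show ?thesis by blast
qed

section \<open>Continuous gradients of polynomials\<close>

text \<open>Having a continuous gradient everywhere is stable under sums, products and powers, so it
  passes from the coordinates to all of \<open>polys\<close>. Continuity is what later makes the
  squared gradient integrable over a cell.\<close>

lemma continuously_differentiable_sum:
  fixes f :: "'i \<Rightarrow> 'a::euclidean_space \<Rightarrow> real"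
  assumes "\<And>i. i \<in> I \<Longrightarrow> \<exists>g. continuous_on UNIV g \<and> (\<forall>x. GDERIV (f i) x :> g x)"
  shows "\<exists>g. continuous_on UNIV g \<and> (\<forall>x. GDERIV (\<lambda>x. \<Sum>i\<in>I. f i x) x :> g x)"
  using assms
proof (induction I rule: infinite_finite_induct)
  case (insert i I)
  then obtain g where "continuous_on UNIV g" "\<And>x. GDERIV (\<lambda>x. \<Sum>i\<in>I. f i x) x :> g x" by auto
  moreover obtain g' where "continuous_on UNIV g'" "\<And>x. GDERIV (f i) x :> g' x"
    using insert.prems[of i] by blast
  ultimately show ?case
    using insert by (intro exI[of _ "\<lambda>x. g' x + g x"]) (auto intro!: continuous_intros GDERIV_add)
qed (auto intro!: exI[of _ "\<lambda>_. 0"] GDERIV_const)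

lemma continuously_differentiable_mult:
  fixes f f' :: "'a::euclidean_space \<Rightarrow> real"
  assumes "\<exists>g. continuous_on UNIV g \<and> (\<forall>x. GDERIV f x :> g x)"
    and "\<exists>g. continuous_on UNIV g \<and> (\<forall>x. GDERIV f' x :> g x)"
  shows "\<exists>g. continuous_on UNIV g \<and> (\<forall>x. GDERIV (\<lambda>x. f x * f' x) x :> g x)"
proof -
  obtain g g' where g: "continuous_on UNIV g" "\<And>x. GDERIV f x :> g x"
    "continuous_on UNIV g'" "\<And>x. GDERIV f' x :> g' x" using assms by auto
  have "continuous_on UNIV f" "continuous_on UNIV f'"
    using g(2,4) unfolding gderiv_def
    by (meson has_derivative_continuous continuous_at_imp_continuous_on)+
  with g show ?thesis
    by (intro exI[of _ "\<lambda>x. f x *\<^sub>R g' x + f' x *\<^sub>R g x"]) (auto intro!: continuous_intros GDERIV_mult)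
qed

lemma continuously_differentiable_power:
  fixes f :: "'a::euclidean_space \<Rightarrow> real"
  assumes "\<exists>g. continuous_on UNIV g \<and> (\<forall>x. GDERIV f x :> g x)"
  shows "\<exists>g. continuous_on UNIV g \<and> (\<forall>x. GDERIV (\<lambda>x. f x ^ n) x :> g x)"
proof (induction n)
  case (Suc n)
  from continuously_differentiable_mult[OF assms Suc] show ?case by simp
qed (auto intro!: exI[of _ "\<lambda>_. 0"] GDERIV_const)

lemma continuously_differentiable_prod:
  fixes f :: "'i \<Rightarrow> 'a::euclidean_space \<Rightarrow> real"
  assumes "\<And>i. i \<in> I \<Longrightarrow> \<exists>g. continuous_on UNIV g \<and> (\<forall>x. GDERIV (f i) x :> g x)"
  shows "\<exists>g. continuous_on UNIV g \<and> (\<forall>x. GDERIV (\<lambda>x. \<Prod>i\<in>I. f i x) x :> g x)"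
  using assms
proof (induction I rule: infinite_finite_induct)
  case (insert i I)
  then show ?case using continuously_differentiable_mult[of "f i" "\<lambda>x. \<Prod>i\<in>I. f i x"] by simp
qed (auto intro!: exI[of _ "\<lambda>_. 0"] GDERIV_const)

lemma polys_continuously_differentiable:
  assumes "p \<in> polys k"
  shows "\<exists>g. continuous_on UNIV g \<and> (\<forall>x. GDERIV p x :> g x)"
proof -
  obtain c where c: "\<And>x. p x = (\<Sum>\<alpha> | (\<Sum>i\<in>UNIV. \<alpha> i) \<le> k. c \<alpha> * (\<Prod>i\<in>UNIV. (x $ i) ^ \<alpha> i))"
    using assms unfolding polys_def by blast
  have coord: "\<exists>g. continuous_on UNIV g \<and> (\<forall>x. GDERIV (\<lambda>x::real^'a. x $ i) x :> g x)" for i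
    by (auto simp: gderiv_def inner_axis bounded_linear_imp_has_derivative bounded_linear_vec_nth
        intro!: exI[of _ "\<lambda>_. axis i 1"])
  have const: "\<exists>g. continuous_on UNIV g \<and> (\<forall>x::real^'a. GDERIV (\<lambda>x. r) x :> g x)" for r :: real
    by (auto intro!: exI[of _ "\<lambda>_. 0"] GDERIV_const)
  show ?thesis
    unfolding ext[of p, OF c]
    by (intro continuously_differentiable_sum continuously_differentiable_mult[OF const]
        continuously_differentiable_prod continuously_differentiable_power coord)
qed

text \<open>The weights depend on the degree only; the nodes \<open>z + (j / (2 * (k + 1))) v\<close> stay on the
  half of the segment near \<open>z\<close>.\<close>

lemma polys_extrapolation:
  "\<exists>w. \<forall>p\<in>polys k :: (real ^ 'd \<Rightarrow> real) set. \<forall>z v.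
     p (z + v) = (\<Sum>j\<le>k. w j * p (z + (real j / (2 * real (k + 1))) *\<^sub>R v))"
proof -
  have "inj_on (\<lambda>j. real j / (2 * real (k + 1))) {..k}" by (auto simp: inj_on_def)
  from lagrange_extrapolation[OF this, of 1] obtain w where
    w: "\<And>Q. degree Q \<le> k \<Longrightarrow> poly Q 1 = (\<Sum>j\<le>k. w j * poly Q (real j / (2 * real (k + 1))))" by blast
  have "p (z + v) = (\<Sum>j\<le>k. w j * p (z + (real j / (2 * real (k + 1))) *\<^sub>R v))"
    if p: "p \<in> polys k" for p and z v :: "real ^ 'd"
  proof -
    obtain Q where Q: "degree Q \<le> k" "\<And>t. p (z + t *\<^sub>R v) = poly Q t"
      using polys_along_line[OF p] by blast
    show ?thesis using w[OF Q(1)] Q(2)[of 1] by (simp add: Q(2))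
  qed
  then show ?thesis by blast
qed

section \<open>Extrapolation of gradients\<close>

lemma GDERIV_translate:
  fixes f :: "'a::euclidean_space \<Rightarrow> real"
  assumes "GDERIV f (z + a) :> D"
  shows "GDERIV (\<lambda>z. f (z + a)) z :> D"
proof -
  have "((\<lambda>z. z + a) has_derivative (\<lambda>h. h)) (at z)" by (auto intro!: derivative_eq_intros)
  from has_derivative_compose[OF this] assms show ?thesis by (simp add: gderiv_def)
qed

lemma GDERIV_unique:
  fixes f :: "'a::euclidean_space \<Rightarrow> real"
  assumes "GDERIV f x :> D" "GDERIV f x :> E"
  shows "D = E"
proof -
  have "(\<lambda>h. h \<bullet> D) = (\<lambda>h. h \<bullet> E)"
    using has_derivative_unique assms unfolding gderiv_def by blast
  then show ?thesis by (metis vector_eq_ldot inner_commute)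
qed

lemma GDERIV_sum:
  fixes f :: "'i \<Rightarrow> 'a::euclidean_space \<Rightarrow> real"
  assumes "\<And>i. i \<in> I \<Longrightarrow> GDERIV (f i) x :> D i"
  shows "GDERIV (\<lambda>x. \<Sum>i\<in>I. f i x) x :> (\<Sum>i\<in>I. D i)"
  using assms unfolding gderiv_def inner_sum_right by (intro has_derivative_sum)

text \<open>Differentiate the identity of \<open>polys_extrapolation\<close> in the base point
  \<open>z\<close> with \<open>v\<close> fixed. Only translations of \<open>p\<close> occur, so the
  weights stay the same and no scale factor appears.\<close>

lemma gradient_extrapolation:
  "\<exists>w. \<forall>p\<in>polys k :: (real ^ 'd \<Rightarrow> real) set. \<forall>g. (\<forall>x. GDERIV p x :> g x) \<longrightarrow>
     (\<forall>z v. g (z + v) = (\<Sum>j\<le>k. w j *\<^sub>R g (z + (real j / (2 * real (k + 1))) *\<^sub>R v)))"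
proof -
  obtain w where w: "\<And>p (z::real^'d) v. p \<in> polys k \<Longrightarrow>
     p (z + v) = (\<Sum>j\<le>k. w j * p (z + (real j / (2 * real (k + 1))) *\<^sub>R v))"
    using polys_extrapolation[of k, where 'd = 'd] by blast
  have "g (z + v) = (\<Sum>j\<le>k. w j *\<^sub>R g (z + (real j / (2 * real (k + 1))) *\<^sub>R v))"
    if p: "p \<in> polys k" and g: "\<forall>x. GDERIV p x :> g x" for p g and z v :: "real^'d"
  proof (rule GDERIV_unique)
    show "GDERIV (\<lambda>z. p (z + v)) z :> g (z + v)"
      using g by (intro GDERIV_translate) auto
    have "GDERIV (\<lambda>z. w j * p (z + a)) z :> w j *\<^sub>R g (z + a)" for j a
      using GDERIV_mult[OF GDERIV_const GDERIV_translate] g by fastforce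
    then have "GDERIV (\<lambda>z. \<Sum>j\<le>k. w j * p (z + (real j / (2 * real (k + 1))) *\<^sub>R v)) z :>
        (\<Sum>j\<le>k. w j *\<^sub>R g (z + (real j / (2 * real (k + 1))) *\<^sub>R v))"
      by (intro GDERIV_sum)
    moreover have "(\<lambda>z. p (z + v)) = (\<lambda>z. \<Sum>j\<le>k. w j * p (z + (real j / (2 * real (k + 1))) *\<^sub>R v))"
      by (rule ext, rule w[OF p])
    ultimately show "GDERIV (\<lambda>z. p (z + v)) z :> (\<Sum>j\<le>k. w j *\<^sub>R g (z + (real j / (2 * real (k + 1))) *\<^sub>R v))"
      by (simp only:)
  qed
  then show ?thesis by blast
qed

section \<open>Integral estimates on compact convex sets\<close>

lemma set_integrable_continuous_compact:
  fixes f :: "'a::euclidean_space \<Rightarrow> real"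
  assumes "compact T" "continuous_on UNIV f"
  shows "set_integrable lborel T f" "set_integrable lebesgue T f"
proof -
  show *: "set_integrable lborel T f"
    unfolding set_integrable_def
    using assms by (intro borel_integrable_compact) (auto intro: continuous_on_subset)
  show "set_integrable lebesgue T f"
    using * unfolding set_integrable_def by (subst integrable_completion) (auto dest: borel_measurable_integrable)
qed

text \<open>Convexity keeps the contraction of ratio \<open>1 - t\<close> towards \<open>x\<close>
  inside \<open>T\<close>, and its Jacobian \<open>(1 - t) ^ DIM('a)\<close> is at least
  \<open>(1/2) ^ DIM('a)\<close>. The factor thus depends neither on \<open>T\<close> nor on
  \<open>x\<close>.\<close>

lemma set_integral_contraction_le:
  fixes f :: "'a::euclidean_space \<Rightarrow> real"
  assumes T: "compact T" "convex T" and f: "continuous_on UNIV f" "\<And>y. 0 \<le> f y"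
    and x: "x \<in> T" and t: "0 \<le> t" "t \<le> 1/2"
  shows "(LINT y:T|lebesgue. f (y + t *\<^sub>R (x - y))) \<le> 2 ^ DIM('a) * (LINT y:T|lebesgue. f y)"
proof -
  let ?F = "\<lambda>y. indicator T y *\<^sub>R f y" and ?\<phi> = "\<lambda>y. t *\<^sub>R x + (1 - t) *\<^sub>R y"
  have F: "integrable lborel ?F"
    using set_integrable_continuous_compact(1)[OF T(1) f(1)] by (simp add: set_integrable_def)
  then have Fm[measurable]: "?F \<in> borel_measurable lborel" by (rule borel_measurable_integrable)
  have c: "1 - t \<noteq> 0" using t by auto
  have contr: "continuous_on UNIV (\<lambda>y. f (y + t *\<^sub>R (x - y)))"
    by (rule continuous_on_compose2[OF f(1)]) (auto intro!: continuous_intros)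
  \<comment> \<open>The substitution rule is read off from this representation of
    \<open>lborel\<close> as a rescaled image of itself, first for integrability of the composite,
    then for its integral.\<close>
  have aff: "lborel = density (distr lborel borel ?\<phi>) (\<lambda>_. ennreal (\<bar>1 - t\<bar> ^ DIM('a)))"
    using lborel_affine[OF c, of "t *\<^sub>R x"] by (simp add: ennreal_power)
  have Fm2: "?F \<in> borel_measurable (distr lborel borel ?\<phi>)" using Fm by simp
  have "integrable (density (distr lborel borel ?\<phi>) (\<lambda>_. ennreal (\<bar>1 - t\<bar> ^ DIM('a)))) ?F"
    using F aff by metis
  then have "integrable (distr lborel borel ?\<phi>) (\<lambda>y. \<bar>1 - t\<bar> ^ DIM('a) *\<^sub>R ?F y)"
    by (subst (asm) integrable_density) (use Fm2 in auto)
  from integrable_scaleR_right[OF this, of "inverse (\<bar>1 - t\<bar> ^ DIM('a))"]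
  have "integrable (distr lborel borel ?\<phi>) ?F" using c by (simp add: mult.assoc[symmetric])
  then have I\<phi>: "integrable lborel (\<lambda>y. ?F (?\<phi> y))"
    by (subst (asm) integrable_distr_eq) (use Fm in auto)
  have "(LINT y|lborel. ?F y) = (LINT y|density (distr lborel borel ?\<phi>) (\<lambda>_. ennreal (\<bar>1 - t\<bar> ^ DIM('a))). ?F y)"
    using aff by metis
  also have "\<dots> = (LINT y|distr lborel borel ?\<phi>. \<bar>1 - t\<bar> ^ DIM('a) *\<^sub>R ?F y)"
    by (rule integral_density) (use Fm2 in auto)
  also have "\<dots> = \<bar>1 - t\<bar> ^ DIM('a) * (LINT y|distr lborel borel ?\<phi>. ?F y)" by simp
  also have "(LINT y|distr lborel borel ?\<phi>. ?F y) = (LINT y|lborel. ?F (?\<phi> y))"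
    by (rule integral_distr) (use Fm in auto)
  finally have sub: "(LINT y|lborel. ?F y) = \<bar>1 - t\<bar> ^ DIM('a) * (LINT y|lborel. ?F (?\<phi> y))" .
  \<comment> \<open>The affine substitution is at hand for \<open>lborel\<close>; on Borel
    integrands the integrals for \<open>lebesgue\<close> and \<open>lborel\<close> agree.\<close>
  have "(LINT y:T|lebesgue. f (y + t *\<^sub>R (x - y))) = (LINT y:T|lborel. f (y + t *\<^sub>R (x - y)))"
    unfolding set_lebesgue_integral_def
    using set_integrable_continuous_compact(1)[OF T(1) contr]
    by (intro integral_completion) (auto simp: set_integrable_def dest: borel_measurable_integrable)
  also have "\<dots> \<le> (LINT y|lborel. ?F (?\<phi> y))"
    unfolding set_lebesgue_integral_def
  proof (rule integral_mono'[OF I\<phi>])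
    fix y
    have eq: "y + t *\<^sub>R (x - y) = ?\<phi> y" by (simp add: algebra_simps)
    have "?\<phi> y \<in> T" if "y \<in> T"
      using convexD[OF T(2) x that, of t "1 - t"] t by simp
    then show "indicator T y *\<^sub>R f (y + t *\<^sub>R (x - y)) \<le> ?F (?\<phi> y)"
      unfolding eq using f(2) by (auto simp: indicator_def)
  qed (use f(2) in \<open>auto simp: indicator_def\<close>)
  also have "\<dots> \<le> 2 ^ DIM('a) * (LINT y|lborel. ?F y)"
  proof -
    have "0 \<le> (LINT y|lborel. ?F (?\<phi> y))" using f(2) by (intro integral_nonneg_AE) auto
    moreover have "1 \<le> 2 ^ DIM('a) * \<bar>1 - t\<bar> ^ DIM('a)"
      unfolding power_mult_distrib[symmetric] using t by (intro one_le_power) auto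
    ultimately have "1 * (LINT y|lborel. ?F (?\<phi> y))
        \<le> (2 ^ DIM('a) * \<bar>1 - t\<bar> ^ DIM('a)) * (LINT y|lborel. ?F (?\<phi> y))"
      by (intro mult_right_mono)
    then show ?thesis unfolding sub by (simp only: mult_1 mult.assoc)
  qed
  also have "(LINT y|lborel. ?F y) = (LINT y:T|lebesgue. f y)"
    unfolding set_lebesgue_integral_def using Fm by (intro integral_completion[symmetric])
  finally show ?thesis .
qed

text \<open>An inverse estimate without a reference cell: each \<open>y\<close> represents
  \<open>g x\<close> by values of \<open>g\<close> on the half of the segment near \<open>y\<close>,
  and averaging over \<open>y\<close> in \<open>T\<close> replaces the usual scaling argument. Hence
  \<open>C\<close> is fixed before \<open>T\<close> and does not see its shape.\<close>

lemma gradient_sup_le_mean_square: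
  "\<exists>C\<ge>0. \<forall>p\<in>polys k :: (real ^ 'd \<Rightarrow> real) set. \<forall>g T. continuous_on UNIV g \<longrightarrow>
     (\<forall>x. GDERIV p x :> g x) \<longrightarrow> compact T \<longrightarrow> convex T \<longrightarrow>
     (\<forall>x\<in>T. (norm (g x))\<^sup>2 * measure lebesgue T \<le> C * (LINT y:T|lebesgue. (norm (g y))\<^sup>2))"
proof -
  define t where "t j = real j / (2 * real (k + 1))" for j
  obtain w where w: "\<forall>p\<in>polys k :: (real ^ 'd \<Rightarrow> real) set. \<forall>g. (\<forall>x. GDERIV p x :> g x) \<longrightarrow>
     (\<forall>z v. g (z + v) = (\<Sum>j\<le>k. w j *\<^sub>R g (z + t j *\<^sub>R v)))"
    using gradient_extrapolation[of k, where 'd = 'd, folded t_def] by (elim exE) (rule that)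
  define W where "W = (\<Sum>j\<le>k. (w j)\<^sup>2)"
  have W: "W \<ge> 0" unfolding W_def by (intro sum_nonneg) auto
  have main: "(norm (g x))\<^sup>2 * measure lebesgue T
      \<le> W * (real (k + 1) * 2 ^ DIM(real^'d)) * (LINT y:T|lebesgue. (norm (g y))\<^sup>2)"
    if p: "p \<in> polys k" "\<forall>x. GDERIV p x :> g x" and g: "continuous_on UNIV g"
      and T: "compact T" "convex T" and x: "x \<in> T" for p g and T :: "(real^'d) set" and x
  proof -
    \<comment> \<open>The extrapolated point is \<open>x\<close> whatever \<open>y\<close> is;
      Cauchy-Schwarz separates the weights from the values.\<close>
    have pt: "(norm (g x))\<^sup>2 \<le> W * (\<Sum>j\<le>k. (norm (g (y + t j *\<^sub>R (x - y))))\<^sup>2)" for y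
    proof -
      have "g x = (\<Sum>j\<le>k. w j *\<^sub>R g (y + t j *\<^sub>R (x - y)))"
        using w[rule_format, OF p(1) p(2)[rule_format], of y "x - y"] by simp
      then have "norm (g x) \<le> (\<Sum>j\<le>k. norm (w j *\<^sub>R g (y + t j *\<^sub>R (x - y))))"
        using norm_sum by metis
      then have "norm (g x) \<le> (\<Sum>j\<le>k. \<bar>w j\<bar> * norm (g (y + t j *\<^sub>R (x - y))))" by simp
      then have "(norm (g x))\<^sup>2 \<le> (\<Sum>j\<le>k. \<bar>w j\<bar> * norm (g (y + t j *\<^sub>R (x - y))))\<^sup>2"
        by (intro power_mono) auto
      also have "\<dots> \<le> (\<Sum>j\<le>k. \<bar>w j\<bar>\<^sup>2) * (\<Sum>j\<le>k. (norm (g (y + t j *\<^sub>R (x - y))))\<^sup>2)"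
        by (rule Cauchy_Schwarz_ineq_sum)
      finally show ?thesis by (simp add: W_def)
    qed
    have cont: "continuous_on UNIV (\<lambda>y. (norm (g (y + t j *\<^sub>R (x - y))))\<^sup>2)" for j
      by (intro continuous_intros continuous_on_compose2[OF g]) auto
    note int = set_integrable_continuous_compact(2)[OF T(1) cont]
    \<comment> \<open>The left side of \<open>pt\<close> is constant in \<open>y\<close>, so
      integrating it over \<open>T\<close> produces the factor
      \<open>measure lebesgue T\<close>.\<close>
    have "(norm (g x))\<^sup>2 * measure lebesgue T = (LINT y:T|lebesgue. (norm (g x))\<^sup>2)"
      using lmeasurable_compact[OF T(1)]
      by (subst set_integral_const) (auto simp: fmeasurable_def)
    also have "\<dots> \<le> (LINT y:T|lebesgue. W * (\<Sum>j\<le>k. (norm (g (y + t j *\<^sub>R (x - y))))\<^sup>2))"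
    proof (rule set_integral_mono)
      show "set_integrable lebesgue T (\<lambda>y. (norm (g x))\<^sup>2)"
        by (intro set_integrable_continuous_compact(2)[OF T(1)] continuous_intros)
      show "set_integrable lebesgue T (\<lambda>y. W * (\<Sum>j\<le>k. (norm (g (y + t j *\<^sub>R (x - y))))\<^sup>2))"
        by (intro set_integrable_continuous_compact(2)[OF T(1)] continuous_intros cont)
    qed (rule pt)
    also have "\<dots> = W * (\<Sum>j\<le>k. (LINT y:T|lebesgue. (norm (g (y + t j *\<^sub>R (x - y))))\<^sup>2))"
    proof -
      have "(LINT y:T|lebesgue. (\<Sum>j\<le>k. (norm (g (y + t j *\<^sub>R (x - y))))\<^sup>2))
          = (\<Sum>j\<le>k. (LINT y:T|lebesgue. (norm (g (y + t j *\<^sub>R (x - y))))\<^sup>2))"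
        using int unfolding set_lebesgue_integral_def set_integrable_def scaleR_sum_right
        by (intro Bochner_Integration.integral_sum)
      then show ?thesis by (simp only: set_integral_mult_right)
    qed
    also have "\<dots> \<le> W * (\<Sum>j\<le>k. 2 ^ DIM(real^'d) * (LINT y:T|lebesgue. (norm (g y))\<^sup>2))"
    proof (intro mult_left_mono W sum_mono set_integral_contraction_le T x)
      show "continuous_on UNIV (\<lambda>y. (norm (g y))\<^sup>2)" by (intro continuous_intros g)
      show "0 \<le> t j" for j by (simp add: t_def)
      show "t j \<le> 1/2" if "j \<in> {..k}" for j using that by (simp add: t_def divide_simps)
    qed simp
    finally show ?thesis by (simp add: mult.assoc)
  qed
  have "W * (real (k + 1) * 2 ^ DIM(real^'d)) \<ge> 0" using W by (intro mult_nonneg_nonneg) auto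
  then show ?thesis
    by (intro exI[of _ "W * (real (k + 1) * 2 ^ DIM(real^'d))"] conjI ballI allI impI)
      (assumption, rule main, assumption+)
qed

section \<open>Hausdorff measure of Lipschitz boundaries\<close>

text \<open>The index is the first one whose right end reaches \<open>u\<close>; minimality puts
  \<open>u\<close> beyond the left end. The intervals are closed, so both \<open>u = 0\<close> and
  \<open>u = R\<close> are covered.\<close>

lemma grid_index_exists:
  fixes u :: real
  assumes "0 \<le> u" "u \<le> R" "N > 0"
  shows "\<exists>i<N. real i * R / real N \<le> u \<and> u \<le> real (Suc i) * R / real N"
proof -
  define P where "P i \<longleftrightarrow> u \<le> real (Suc i) * R / real N" for i
  have PN: "P (N - 1)" using assms by (simp add: P_def of_nat_diff)
  define i where "i = (LEAST i. P i)"
  have "P i" unfolding i_def by (rule LeastI[of P, OF PN])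
  have "i \<le> N - 1" unfolding i_def by (rule Least_le[of P, OF PN])
  then have "i < N" using assms by simp
  have "real i * R / real N \<le> u"
  proof (cases i)
    case (Suc j)
    then have "\<not> P j" using not_less_Least[of j P] by (simp add: i_def)
    then show ?thesis by (simp add: P_def Suc)
  qed (use assms in simp)
  with \<open>P i\<close> \<open>i < N\<close> show ?thesis by (auto simp: P_def)
qed

text \<open>Cover by the cells of an \<open>N\<close>-fold subdivision of each side of the coordinate cube: the number of
  cells and the cost of a cell scale inversely, so the bound survives the refinement.\<close>

lemma hausdorff_outer_le_of_coordinates:
  fixes A :: "'a::metric_space set" and f :: "'j \<Rightarrow> 'a \<Rightarrow> real"
  assumes J: "finite J" and M: "0 \<le> M" and R: "0 \<le> R"
    and dist_le: "\<And>x y b. x \<in> A \<Longrightarrow> y \<in> A \<Longrightarrow> 0 \<le> b \<Longrightarrow> (\<And>j. j \<in> J \<Longrightarrow> \<bar>f j x - f j y\<bar> \<le> b) \<Longrightarrow> dist x y \<le> M * b"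
    and range: "\<And>x j. x \<in> A \<Longrightarrow> j \<in> J \<Longrightarrow> a j \<le> f j x \<and> f j x \<le> a j + R"
  shows "hausdorff_outer (card J) A \<le> ennreal (unit_ball_vol (real (card J)) * (M * R / 2) ^ card J)"
  unfolding hausdorff_outer_def
proof (rule SUP_least)
  fix \<delta> :: real assume "\<delta> \<in> {0<..}"
  then have \<delta>: "\<delta> > 0" by simp
  define s where "s = card J"
  \<comment> \<open>\<open>N\<close> is large enough for the bound \<open>M * R / N\<close> on the
    diameter of a cell to be admissible for \<open>\<delta>\<close>; the successor keeps
    \<open>N\<close> positive.\<close>
  obtain N0 :: nat where N0: "M * R / \<delta> < real N0" using reals_Archimedean2 by blast
  define N where "N = Suc N0"
  have N: "N > 0" "M * R / real N \<le> \<delta>"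
  proof -
    have "M * R / \<delta> \<le> real N" using N0 by (simp add: N_def)
    then show "M * R / real N \<le> \<delta>" using \<delta> by (simp add: N_def field_simps)
  qed (simp add: N_def)
  \<comment> \<open>Cells are cut out of \<open>A\<close> itself, because \<open>dist_le\<close>
    compares points of \<open>A\<close> only.\<close>
  define cell where "cell c = {x \<in> A. \<forall>j\<in>J. a j + real (c j) * R / real N \<le> f j x \<and>
      f j x \<le> a j + real (Suc (c j)) * R / real N}" for c :: "'j \<Rightarrow> nat"
  define cells where "cells = (J \<rightarrow>\<^sub>E {..<N})"
  have fin: "finite cells" unfolding cells_def using J by (intro finite_PiE) auto
  have cardc: "card cells = N ^ s" unfolding cells_def s_def using J by (simp add: card_PiE)
  have cell_dist: "dist x y \<le> M * R / real N" if "x \<in> cell c" "y \<in> cell c" for x y c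
  proof -
    have "dist x y \<le> M * (R / real N)"
    proof (rule dist_le)
      fix j assume "j \<in> J"
      then have "a j + real (c j) * R / real N \<le> f j x" "f j x \<le> a j + real (Suc (c j)) * R / real N"
        "a j + real (c j) * R / real N \<le> f j y" "f j y \<le> a j + real (Suc (c j)) * R / real N"
        using that by (auto simp: cell_def)
      moreover have "real (Suc (c j)) * R / real N = real (c j) * R / real N + R / real N"
        by (simp add: add_divide_distrib distrib_right)
      ultimately show "\<bar>f j x - f j y\<bar> \<le> R / real N" by linarith
    qed (use that R in \<open>auto simp: cell_def\<close>)
    then show ?thesis by simp
  qed
  have cell_bounded: "bounded (cell c)" for c
    using cell_dist by (metis bounded_any_center bounded_def)
  have cell_diam: "diameter (cell c) \<le> M * R / real N" for c
    unfolding diameter_def using cell_dist M R by (auto intro!: cSUP_least)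
  have cell_cost: "hausdorff_cost s (cell c) \<le> ennreal (unit_ball_vol (real s) * (M * R / real N / 2) ^ s)" for c
    unfolding hausdorff_cost_def
    using cell_diam[of c] diameter_ge_0[OF cell_bounded[of c]]
    by (auto intro!: ennreal_leI mult_left_mono power_mono)
  have cover: "\<exists>c\<in>cells. x \<in> cell c" if x: "x \<in> A" for x
  proof -
    have "\<exists>i<N. real i * R / real N \<le> f j x - a j \<and> f j x - a j \<le> real (Suc i) * R / real N" if "j \<in> J" for j
      using range[OF x that] N by (intro grid_index_exists) auto
    then obtain c where c: "\<And>j. j \<in> J \<Longrightarrow> c j < N \<and> real (c j) * R / real N \<le> f j x - a j \<and>
        f j x - a j \<le> real (Suc (c j)) * R / real N" by metis
    have "restrict c J \<in> cells" using c by (auto simp: cells_def)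
    moreover have "x \<in> cell (restrict c J)" using c x by (fastforce simp: cell_def)
    ultimately show ?thesis by blast
  qed
  obtain e where e: "bij_betw e {0..<N ^ s} cells" using ex_bij_betw_nat_finite[OF fin] cardc by auto
  \<comment> \<open>The premeasure asks for an infinite sequence, so the finite list of cells is
    padded with empty sets. These cost \<open>0\<close> by definition, even in dimension
    \<open>0\<close>.\<close>
  define C where "C i = (if i < N ^ s then cell (e i) else {})" for i
  have "A \<subseteq> (\<Union>i. C i)"
  proof
    fix x assume "x \<in> A"
    then obtain c where "c \<in> cells" "x \<in> cell c" using cover by blast
    moreover from this e obtain i where "i < N ^ s" "e i = c" by (auto simp: bij_betw_def image_iff)
    ultimately have "x \<in> C i" by (simp add: C_def)
    then show "x \<in> (\<Union>i. C i)" by blast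
  qed
  moreover have "bounded (C i) \<and> diameter (C i) \<le> \<delta>" for i
    using cell_bounded cell_diam[of "e i"] N(2) \<delta> by (auto simp: C_def)
  ultimately have "hausdorff_premeasure (card J) \<delta> A \<le> (\<Sum>i. hausdorff_cost s (C i))"
    unfolding hausdorff_premeasure_def s_def by (intro INF_lower) auto
  also have "\<dots> = (\<Sum>i<N ^ s. hausdorff_cost s (C i))"
    by (rule suminf_finite) (auto simp: C_def hausdorff_cost_def)
  also have "\<dots> \<le> (\<Sum>i<N ^ s. ennreal (unit_ball_vol (real s) * (M * R / real N / 2) ^ s))"
    using cell_cost[of "e _"] by (intro sum_mono) (simp add: C_def)
  also have "\<dots> = of_nat (N ^ s) * ennreal (unit_ball_vol (real s) * (M * R / real N / 2) ^ s)" by simp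
  also have "\<dots> = ennreal (real (N ^ s) * (unit_ball_vol (real s) * (M * R / real N / 2) ^ s))"
    by (subst ennreal_of_nat_eq_real_of_nat, subst ennreal_mult) (use M R in auto)
  also have "real (N ^ s) * (unit_ball_vol (real s) * (M * R / real N / 2) ^ s)
      = unit_ball_vol (real s) * (M * R / 2) ^ s"
    using N by (simp add: power_divide)
  finally show "hausdorff_premeasure (card J) \<delta> A \<le> ennreal (unit_ball_vol (real (card J)) * (M * R / 2) ^ card J)"
    by (simp add: s_def)
qed

section \<open>Lipschitz graphs and the compact boundary\<close>

text \<open>Orthogonality to \<open>e\<close> expresses \<open>w $ i\<close> through the other
  coordinates, at the price of dividing by \<open>e $ i\<close>. So \<open>CARD('d) - 1\<close>
  coordinates control a vector of the hyperplane, which gives the covering argument the right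
  dimension.\<close>

lemma norm_le_of_orthogonal_coordinates:
  fixes w e :: "real ^ 'd"
  assumes e: "norm e = 1" "e $ i \<noteq> 0" and orth: "w \<bullet> e = 0"
    and b: "\<And>j. j \<noteq> i \<Longrightarrow> \<bar>w $ j\<bar> \<le> b"
  shows "norm w \<le> real (CARD('d) - 1) * (1 + 1 / \<bar>e $ i\<bar>) * b"
proof -
  have *: "(\<Sum>j\<in>UNIV. g j) = g i + (\<Sum>j\<in>UNIV - {i}. g j)" for g :: "'d \<Rightarrow> real"
    by (rule sum.remove) auto
  have "(w $ i) * (e $ i) = - (\<Sum>j\<in>UNIV - {i}. (w $ j) * (e $ j))"
    using orth by (simp add: inner_vec_def *)
  then have "\<bar>w $ i\<bar> * \<bar>e $ i\<bar> \<le> (\<Sum>j\<in>UNIV - {i}. \<bar>(w $ j) * (e $ j)\<bar>)"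
    using sum_abs[of "\<lambda>j. (w $ j) * (e $ j)" "UNIV - {i}"] by (simp only: abs_mult[symmetric] abs_minus_cancel)
  also have "\<dots> \<le> (\<Sum>j\<in>UNIV - {i}. b)"
  proof (rule sum_mono)
    fix j assume "j \<in> UNIV - {i}"
    then have "\<bar>w $ j\<bar> \<le> b" using b by auto
    moreover have "\<bar>e $ j\<bar> \<le> 1" using component_le_norm_cart[of e j] e by simp
    ultimately show "\<bar>(w $ j) * (e $ j)\<bar> \<le> b"
      unfolding abs_mult using mult_mono[of "\<bar>w $ j\<bar>" b "\<bar>e $ j\<bar>" 1] by auto
  qed
  finally have wi: "\<bar>w $ i\<bar> \<le> real (CARD('d) - 1) * b / \<bar>e $ i\<bar>"
    using e by (simp add: field_simps)
  have "norm w \<le> (\<Sum>j\<in>UNIV. \<bar>w $ j\<bar>)" by (rule norm_le_l1_cart)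
  also have "\<dots> = \<bar>w $ i\<bar> + (\<Sum>j\<in>UNIV - {i}. \<bar>w $ j\<bar>)" by (rule *)
  also have "(\<Sum>j\<in>UNIV - {i}. \<bar>w $ j\<bar>) \<le> (\<Sum>j\<in>UNIV - {i}. b)" by (intro sum_mono b) auto
  also have "\<bar>w $ i\<bar> + (\<Sum>j\<in>UNIV - {i}. b) \<le> real (CARD('d) - 1) * b / \<bar>e $ i\<bar> + real (CARD('d) - 1) * b"
    using wi by (simp add: card_Diff_singleton)
  finally show ?thesis by (simp add: algebra_simps)
qed

text \<open>The graph is measured through its projection \<open>P\<close> along \<open>e\<close>:
  distances on the graph are at most \<open>1 + L\<close> times those of the projections, and the
  latter are controlled by \<open>CARD('d) - 1\<close> coordinates. \<open>C\<close> is fixed before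
  \<open>S\<close> and \<open>h\<close>.\<close>

lemma hausdorff_outer_lipschitz_graph_le:
  fixes e :: "real ^ 'd"
  assumes e: "norm e = 1" and lip: "L-lipschitz_on {y. y \<bullet> e = 0} \<phi>"
  shows "\<exists>C\<ge>0. \<forall>S h. (\<forall>x\<in>S. x \<bullet> e = \<phi> (x - (x \<bullet> e) *\<^sub>R e)) \<longrightarrow> 0 \<le> h \<longrightarrow> (\<forall>x\<in>S. \<forall>y\<in>S. dist x y \<le> h) \<longrightarrow>
    hausdorff_outer (CARD('d) - 1) S \<le> ennreal (C * h ^ (CARD('d) - 1))"
proof -
  define s where "s = CARD('d) - 1"
  have "e \<noteq> 0" using e by auto
  then obtain i where i: "e $ i \<noteq> 0" by (auto simp: vec_eq_iff)
  define J where "J = UNIV - {i}"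
  have J: "finite J" "card J = s" by (auto simp: J_def s_def card_Diff_singleton)
  have L: "0 \<le> L" using lip lipschitz_on_nonneg by blast
  \<comment> \<open>The factor \<open>1 + L\<close> comes from the graph, the other one from
    \<open>norm_le_of_orthogonal_coordinates\<close>.\<close>
  define M where "M = (1 + L) * (real s * (1 + 1 / \<bar>e $ i\<bar>))"
  have M: "0 \<le> M" using L by (auto simp: M_def intro!: mult_nonneg_nonneg)
  define C where "C = unit_ball_vol (real s) * (M * 4 / 2) ^ s"
  have C: "0 \<le> C" using M by (auto simp: C_def)
  have "hausdorff_outer s S \<le> ennreal (C * h ^ s)"
    if S: "\<forall>x\<in>S. x \<bullet> e = \<phi> (x - (x \<bullet> e) *\<^sub>R e)" and h: "0 \<le> h" and diam: "\<forall>x\<in>S. \<forall>y\<in>S. dist x y \<le> h" for S h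
  proof (cases "S = {}")
    case True
    then show ?thesis by (simp add: hausdorff_outer_empty)
  next
    case False
    then obtain x0 where x0: "x0 \<in> S" by blast
    define P where "P x = x - (x \<bullet> e) *\<^sub>R e" for x
    have Porth: "P x \<bullet> e = 0" for x
      using e by (simp add: P_def inner_diff_left dot_square_norm)
    have Pd: "P x - P y = (x - y) - ((x - y) \<bullet> e) *\<^sub>R e" for x y
      by (simp add: P_def inner_diff_left algebra_simps)
    have Pn: "norm (P x - P y) \<le> 2 * dist x y" for x y
    proof -
      have "norm (P x - P y) \<le> norm (x - y) + norm (((x - y) \<bullet> e) *\<^sub>R e)"
        unfolding Pd by (rule norm_triangle_ineq4)
      also have "norm (((x - y) \<bullet> e) *\<^sub>R e) \<le> norm (x - y)"
        using Cauchy_Schwarz_ineq2[of "x - y" e] e by simp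
      finally show ?thesis by (simp add: dist_norm)
    qed
    \<comment> \<open>By \<open>Pn\<close> the coordinates of \<open>P\<close> stay within
      \<open>2 * h\<close> of those of \<open>P x0\<close>, hence in intervals of length
      \<open>4 * h\<close>; this is the \<open>4\<close> in \<open>C\<close>.\<close>
    have "hausdorff_outer (card J) S \<le> ennreal (unit_ball_vol (real (card J)) * (M * (4 * h) / 2) ^ card J)"
    proof (rule hausdorff_outer_le_of_coordinates[where f = "\<lambda>j x. P x $ j" and a = "\<lambda>j. P x0 $ j - 2 * h"])
      fix x y b assume xy: "x \<in> S" "y \<in> S" and b: "0 \<le> (b::real)"
        "\<And>j. j \<in> J \<Longrightarrow> \<bar>P x $ j - P y $ j\<bar> \<le> b"
      have w: "norm (P x - P y) \<le> real s * (1 + 1 / \<bar>e $ i\<bar>) * b"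
        unfolding s_def using b Porth
        by (intro norm_le_of_orthogonal_coordinates e i) (auto simp: inner_diff_left J_def)
      have "x - y = (P x - P y) + (\<phi> (P x) - \<phi> (P y)) *\<^sub>R e"
        using S xy unfolding P_def by (simp add: algebra_simps)
      then have "dist x y \<le> norm (P x - P y) + norm ((\<phi> (P x) - \<phi> (P y)) *\<^sub>R e)"
        unfolding dist_norm by (metis norm_triangle_ineq)
      also have "norm ((\<phi> (P x) - \<phi> (P y)) *\<^sub>R e) \<le> L * norm (P x - P y)"
        using lipschitz_onD[OF lip, of "P x" "P y"] Porth e by (simp add: dist_norm)
      finally have "dist x y \<le> (1 + L) * norm (P x - P y)" by (simp add: algebra_simps)
      also have "\<dots> \<le> (1 + L) * (real s * (1 + 1 / \<bar>e $ i\<bar>) * b)"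
        using L w by (intro mult_left_mono) auto
      finally show "dist x y \<le> M * b" by (simp add: M_def mult.assoc)
    next
      fix x j assume "x \<in> S"
      then have "norm (P x - P x0) \<le> 2 * h" using Pn[of x x0] diam x0 by fastforce
      then show "P x0 $ j - 2 * h \<le> P x $ j \<and> P x $ j \<le> P x0 $ j - 2 * h + 4 * h"
        using component_le_norm_cart[of "P x - P x0" j] by auto
    qed (use J M h in auto)
    then show ?thesis by (simp add: J C_def power_mult_distrib algebra_simps)
  qed
  with C show ?thesis unfolding s_def by blast
qed

text \<open>A boundary point of an open set is outside it, which gives one inequality by
  \<open>sub\<close>; it is also a limit of points of the set inside the ball, where the strict
  inequality holds, and continuity of \<open>\<phi>\<close> after projection gives the
  other.\<close>

lemma frontier_lipschitz_domain_graph: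
  assumes lip: "L-lipschitz_on {y. y \<bullet> e = 0} \<phi>" and e: "norm e = 1" and op: "open \<Omega>"
    and sub: "\<Omega> \<inter> ball x r = {y \<in> ball x r. y \<bullet> e < \<phi> (y - (y \<bullet> e) *\<^sub>R e)}"
    and y: "y \<in> frontier \<Omega>" "y \<in> ball x r"
  shows "y \<bullet> e = \<phi> (y - (y \<bullet> e) *\<^sub>R e)"
proof (rule antisym)
  have "y \<notin> \<Omega>" using y(1) op by (simp add: frontier_def interior_open)
  then show "\<phi> (y - (y \<bullet> e) *\<^sub>R e) \<le> y \<bullet> e" using sub y(2) by (metis (mono_tags, lifting) IntD1 leI mem_Collect_eq)
  have orth: "(z - (z \<bullet> e) *\<^sub>R e) \<bullet> e = 0" for z
    using e by (simp add: inner_diff_left dot_square_norm)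
  have "continuous_on UNIV (\<lambda>z. \<phi> (z - (z \<bullet> e) *\<^sub>R e))"
    by (rule continuous_on_compose2[OF lipschitz_on_continuous_on[OF lip]])
      (auto intro!: continuous_intros simp: orth)
  then have cl: "closed {z. z \<bullet> e \<le> \<phi> (z - (z \<bullet> e) *\<^sub>R e)}"
    by (intro closed_Collect_le continuous_intros)
  have "y \<in> closure \<Omega>" using y(1) by (simp add: frontier_def)
  then have "y \<in> closure (ball x r \<inter> \<Omega>)"
    using open_Int_closure_subset[of "ball x r" \<Omega>] y(2) by auto
  also have "\<dots> \<subseteq> {z. z \<bullet> e \<le> \<phi> (z - (z \<bullet> e) *\<^sub>R e)}"
  proof (rule closure_minimal[OF _ cl], rule subsetI)
    fix z assume "z \<in> ball x r \<inter> \<Omega>"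
    then have "z \<in> {y \<in> ball x r. y \<bullet> e < \<phi> (y - (y \<bullet> e) *\<^sub>R e)}" unfolding sub[symmetric] by blast
    then show "z \<in> {z. z \<bullet> e \<le> \<phi> (z - (z \<bullet> e) *\<^sub>R e)}" by simp
  qed
  finally show "y \<bullet> e \<le> \<phi> (y - (y \<bullet> e) *\<^sub>R e)" by simp
qed

lemma hausdorff_outer_Union_finite:
  assumes "finite X"
  shows "hausdorff_outer s (\<Union>x\<in>X. A x) \<le> (\<Sum>x\<in>X. hausdorff_outer s (A x))"
  using assms
proof (induction X rule: finite_induct)
  case (insert x X)
  have "hausdorff_outer s (\<Union>x\<in>insert x X. A x) \<le> hausdorff_outer s (A x) + hausdorff_outer s (\<Union>x\<in>X. A x)"
    by (simp add: hausdorff_outer_Un)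
  also have "\<dots> \<le> hausdorff_outer s (A x) + (\<Sum>x\<in>X. hausdorff_outer s (A x))"
    by (intro add_left_mono insert)
  finally show ?case using insert by simp
qed (simp add: hausdorff_outer_empty)

text \<open>Compactness reduces the boundary to finitely many charts, each contributing a piece of a
  Lipschitz graph.\<close>

lemma hausdorff_outer_frontier_le:
  fixes \<Omega> :: "(real ^ 'd) set"
  assumes "lipschitz_domain \<Omega>" "bounded \<Omega>"
  shows "\<exists>C\<ge>0. \<forall>S h. 0 \<le> h \<longrightarrow> (\<forall>x\<in>S. \<forall>y\<in>S. dist x y \<le> h) \<longrightarrow>
    hausdorff_outer (CARD('d) - 1) (S \<inter> frontier \<Omega>) \<le> ennreal (C * h ^ (CARD('d) - 1))"
proof -
  define s where "s = CARD('d) - 1"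
  have op: "open \<Omega>" using assms by (simp add: lipschitz_domain_def)
  have charts: "\<forall>x\<in>frontier \<Omega>. \<exists>e r L \<phi>. norm e = 1 \<and> r > 0 \<and> L-lipschitz_on {y. y \<bullet> e = 0} \<phi> \<and>
      \<Omega> \<inter> ball x r = {y \<in> ball x r. y \<bullet> e < \<phi> (y - (y \<bullet> e) *\<^sub>R e)}"
    using assms(1) unfolding lipschitz_domain_def by (elim conjE)
  have "\<exists>r C. r > 0 \<and> 0 \<le> C \<and> (\<forall>S h. 0 \<le> h \<longrightarrow> (\<forall>x\<in>S. \<forall>y\<in>S. dist x y \<le> h) \<longrightarrow>
      hausdorff_outer s (S \<inter> frontier \<Omega> \<inter> ball x r) \<le> ennreal (C * h ^ s))"
    if x: "x \<in> frontier \<Omega>" for x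
  proof -
    obtain e r L \<phi> where *: "norm e = 1" "r > 0" "L-lipschitz_on {y. y \<bullet> e = 0} \<phi>"
        "\<Omega> \<inter> ball x r = {y \<in> ball x r. y \<bullet> e < \<phi> (y - (y \<bullet> e) *\<^sub>R e)}"
      using charts[rule_format, OF x] by (elim exE conjE) (rule that)
    obtain C where C: "0 \<le> C" "\<And>S h. (\<forall>x\<in>S. x \<bullet> e = \<phi> (x - (x \<bullet> e) *\<^sub>R e)) \<Longrightarrow> 0 \<le> h \<Longrightarrow>
        (\<forall>x\<in>S. \<forall>y\<in>S. dist x y \<le> h) \<Longrightarrow> hausdorff_outer s S \<le> ennreal (C * h ^ s)"
      using hausdorff_outer_lipschitz_graph_le[OF *(1,3)] unfolding s_def by metis
    have "hausdorff_outer s (S \<inter> frontier \<Omega> \<inter> ball x r) \<le> ennreal (C * h ^ s)"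
      if "0 \<le> h" "\<forall>x\<in>S. \<forall>y\<in>S. dist x y \<le> h" for S h
      using that frontier_lipschitz_domain_graph[OF *(3,1) op *(4)] by (intro C(2)) auto
    with *(2) C(1) show ?thesis by blast
  qed
  then obtain r C where rC: "\<And>x. x \<in> frontier \<Omega> \<Longrightarrow> r x > 0" "\<And>x. x \<in> frontier \<Omega> \<Longrightarrow> 0 \<le> C x"
    "\<And>x S h. x \<in> frontier \<Omega> \<Longrightarrow> 0 \<le> h \<Longrightarrow> (\<forall>x\<in>S. \<forall>y\<in>S. dist x y \<le> h) \<Longrightarrow>
      hausdorff_outer s (S \<inter> frontier \<Omega> \<inter> ball x (r x)) \<le> ennreal (C x * h ^ s)"
    by metis
  have K: "compact (frontier \<Omega>)" using assms(2) by (rule compact_frontier_bounded)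
  have cov: "frontier \<Omega> \<subseteq> (\<Union>x\<in>frontier \<Omega>. ball x (r x))" using rC(1) by force
  \<comment> \<open>The subcover is chosen before \<open>S\<close> and \<open>h\<close>, so the
    constant \<open>sum C X\<close> depends on the domain only.\<close>
  obtain X where X: "X \<subseteq> frontier \<Omega>" "finite X" "frontier \<Omega> \<subseteq> (\<Union>x\<in>X. ball x (r x))"
    by (rule compactE_image[OF K _ cov]) (auto intro: that)
  have "hausdorff_outer s (S \<inter> frontier \<Omega>) \<le> ennreal (sum C X * h ^ s)"
    if h: "0 \<le> h" "\<forall>x\<in>S. \<forall>y\<in>S. dist x y \<le> h" for S h
  proof -
    have "hausdorff_outer s (S \<inter> frontier \<Omega>)
        \<le> hausdorff_outer s (\<Union>x\<in>X. S \<inter> frontier \<Omega> \<inter> ball x (r x))"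
      using X(3) by (intro hausdorff_outer_mono) blast
    also have "\<dots> \<le> (\<Sum>x\<in>X. hausdorff_outer s (S \<inter> frontier \<Omega> \<inter> ball x (r x)))"
      by (rule hausdorff_outer_Union_finite[OF X(2)])
    also have "\<dots> \<le> (\<Sum>x\<in>X. ennreal (C x * h ^ s))"
      using X(1) by (intro sum_mono rC(3) h) auto
    also have "\<dots> = ennreal (sum C X * h ^ s)"
      using X(1) rC(2) h by (subst sum_ennreal) (auto simp: sum_distrib_right intro!: mult_nonneg_nonneg)
    finally show ?thesis .
  qed
  moreover have "0 \<le> sum C X" using X(1) rC(2) by (intro sum_nonneg) auto
  ultimately show ?thesis unfolding s_def by blast
qed

section \<open>Cut cells\<close>

lemma gradient_eq:
  assumes "GDERIV u x :> D"
  shows "gradient u x = D"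
proof -
  have "u differentiable (at x)" using assms unfolding gderiv_def differentiable_def by blast
  then show ?thesis unfolding gradient_def using assms GDERIV_unique by (auto intro!: the_equality)
qed

lemma gradient_eq_on_open:
  assumes "open U" "x \<in> U" "\<And>y. y \<in> U \<Longrightarrow> u y = p y" "GDERIV p x :> D"
  shows "gradient u x = D"
proof (rule gradient_eq)
  show "GDERIV u x :> D"
    using assms(4) unfolding gderiv_def
    by (rule has_derivative_transform_within_open[OF _ assms(1,2)]) (simp add: assms(3))
qed

text \<open>The mean value inequality on the convex set \<open>T\<close>, started at the zero
  \<open>x0\<close>. \<open>B\<close> bounds the squared gradient because the mean square estimate
  supplies it in that form.\<close>

lemma square_le_of_zero:
  fixes p :: "'a::euclidean_space \<Rightarrow> real"
  assumes p: "\<And>x. GDERIV p x :> g x" and T: "convex T" and x: "x \<in> T" and x0: "x0 \<in> T" "p x0 = 0"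
    and d: "dist x x0 \<le> h" and B: "0 \<le> B" "\<And>y. y \<in> T \<Longrightarrow> (norm (g y))\<^sup>2 \<le> B"
  shows "(p x)\<^sup>2 \<le> h\<^sup>2 * B"
proof -
  have "norm (p x - p x0) \<le> sqrt B * norm (x - x0)"
  proof (rule differentiable_bound[OF T _ _ x x0(1)])
    show "(p has_derivative (\<lambda>h. h \<bullet> g y)) (at y within T)" for y
      using p[of y] by (auto simp: gderiv_def intro: has_derivative_at_withinI)
    show "onorm (\<lambda>h. h \<bullet> g y) \<le> sqrt B" if "y \<in> T" for y
    proof (rule onorm_le)
      fix v :: 'a
      have "norm (v \<bullet> g y) \<le> norm v * norm (g y)" using Cauchy_Schwarz_ineq2[of v "g y"] by simp
      also have "\<dots> \<le> norm v * sqrt B" using B(2)[OF that] by (intro mult_left_mono real_le_rsqrt) auto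
      finally show "norm (v \<bullet> g y) \<le> sqrt B * norm v" by (simp add: mult.commute)
    qed
  qed
  also have "\<dots> \<le> sqrt B * h" using d B by (intro mult_left_mono) (auto simp: dist_norm)
  finally have "\<bar>p x\<bar>\<^sup>2 \<le> (sqrt B * h)\<^sup>2" using x0(2) by (intro power_mono) auto
  then show ?thesis using B(1) by (simp add: power_mult_distrib mult.commute)
qed

text \<open>The cell contains a ball of radius comparable to its diameter. The denominator
  \<open>4 * \<bar>\<sigma>\<bar> + 1\<close> is positive for every real \<open>\<sigma>\<close>, so
  the constant makes sense before any mesh is given.\<close>

lemma shape_regular_simplex:
  fixes T :: "(real ^ 'd) set"
  assumes T: "int CARD('d) simplex T" and reg: "diameter T \<le> \<sigma> * inball_diameter T"
  shows "0 < diameter T"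
    and "unit_ball_vol (real CARD('d)) * (diameter T / (4 * \<bar>\<sigma>\<bar> + 1)) ^ CARD('d) \<le> measure lebesgue T"
proof -
  have comp: "compact T" and conv: "convex T" using compact_simplex convex_simplex T by blast+
  then have bdd: "bounded T" using compact_imp_bounded by blast
  define D where "D = {2 * r | r. r > 0 \<and> (\<exists>x. cball x r \<subseteq> T)}"
  \<comment> \<open>Full dimension gives an interior point, so \<open>D\<close> is nonempty;
    together with the bound by the diameter this makes \<open>Sup D\<close> a genuine
    supremum.\<close>
  have "aff_dim T = int (DIM(real^'d))" using aff_dim_simplex[OF T] by simp
  then have "affine hull T = UNIV" "T \<noteq> {}" using aff_dim_eq_full[of T] by auto
  then have "interior T \<noteq> {}" using rel_interior_interior rel_interior_eq_empty[OF conv] by metis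
  then obtain x e where e: "e > 0" "cball x e \<subseteq> T" using mem_interior_cball by blast
  have le: "2 * r \<le> diameter T" if "r > 0" "cball x r \<subseteq> T" for x r
    using diameter_subset[OF that(2) bdd] that(1) by simp
  then show pos: "0 < diameter T" using e by force
  have eD: "2 * e \<in> D" using e by (auto simp: D_def)
  have "2 * e \<le> Sup D"
    by (rule cSup_upper[OF eD]) (auto simp: bdd_above_def D_def intro: le)
  then have S: "Sup D > 0" using e by simp
  have reg': "diameter T \<le> \<sigma> * Sup D" using reg by (simp add: inball_diameter_def D_def)
  then have \<sigma>: "\<sigma> > 0" using pos S by (smt (verit) mult_nonpos_nonneg)
  \<comment> \<open>The supremum is not assumed to be attained. Giving away a factor
    \<open>2\<close> makes the inequality strict and yields an actual inscribed ball.\<close>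
  have "diameter T / (2 * \<sigma>) < Sup D" using reg' pos \<sigma> S by (simp add: field_simps)
  then obtain d where "d \<in> D" "diameter T / (2 * \<sigma>) < d" using less_cSupE eD by blast
  then obtain r z where r: "r > 0" "cball z r \<subseteq> T" "diameter T / (2 * \<sigma>) < 2 * r" by (auto simp: D_def)
  have "diameter T / (4 * \<bar>\<sigma>\<bar> + 1) \<le> diameter T / (4 * \<sigma>)"
    using pos \<sigma> by (intro divide_left_mono) auto
  also have "\<dots> \<le> r" using r(3) \<sigma> by (simp add: field_simps)
  finally have "diameter T / (4 * \<bar>\<sigma>\<bar> + 1) \<le> r" .
  then have "unit_ball_vol (real CARD('d)) * (diameter T / (4 * \<bar>\<sigma>\<bar> + 1)) ^ CARD('d)
      \<le> unit_ball_vol (real CARD('d)) * r ^ CARD('d)"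
    using pos by (intro mult_left_mono power_mono) auto
  also have "\<dots> = measure lebesgue (cball z r)"
    using content_cball[of r z] r(1) by simp
  also have "\<dots> \<le> measure lebesgue T"
    using r(2) lmeasurable_compact[OF comp] by (intro measure_mono_fmeasurable) auto
  finally show "unit_ball_vol (real CARD('d)) * (diameter T / (4 * \<bar>\<sigma>\<bar> + 1)) ^ CARD('d) \<le> measure lebesgue T" .
qed

text \<open>The cells overlap in a null set only, and there the gradient may have the junk value \<open>0\<close>.\<close>

lemma dirichlet_form_eq_sum:
  fixes u :: "real ^ 'd \<Rightarrow> real"
  assumes mesh: "simplicial_mesh \<Omega>s \<T>"
    and p: "\<And>T x. T \<in> active_mesh \<Omega> \<T> \<Longrightarrow> x \<in> T \<Longrightarrow> u x = p T x"
    and g: "\<And>T x. T \<in> active_mesh \<Omega> \<T> \<Longrightarrow> GDERIV (p T) x :> g T x"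
    and cont: "\<And>T. T \<in> active_mesh \<Omega> \<T> \<Longrightarrow> continuous_on UNIV (g T)"
  shows "dirichlet_form \<Omega> \<T> u u = (\<Sum>T\<in>active_mesh \<Omega> \<T>. LINT x:T|lebesgue. (norm (g T x))\<^sup>2)"
proof -
  let ?A = "active_mesh \<Omega> \<T>"
  have sub: "?A \<subseteq> \<T>" by (auto simp: active_mesh_def)
  have tri: "triangulation \<T>" and simp: "\<And>T. T \<in> \<T> \<Longrightarrow> int CARD('d) simplex T"
    using mesh by (auto simp: simplicial_mesh_def)
  have fin: "finite ?A" using tri finite_subset[OF sub] by (auto simp: triangulation_def)
  \<comment> \<open>The intersection of two cells is a face of each, and a face that meets the
    interior is the whole cell.\<close>
  have unique: "T = T'" if "T \<in> ?A" "T' \<in> ?A" "x \<in> T" "x \<in> T'" "x \<in> interior T" "x \<in> interior T'" for T T' x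
  proof -
    have "(T \<inter> T') face_of T" "(T' \<inter> T) face_of T'"
      using tri that sub unfolding triangulation_def by blast+
    then have "T \<inter> T' = T" "T' \<inter> T = T'" using face_of_disjoint_interior that by blast+
    then show ?thesis by blast
  qed
  define N where "N = (\<Union>T\<in>?A. frontier T)"
  have "negligible N"
    unfolding N_def using fin simp sub
    by (intro negligible_Union) (auto intro!: negligible_convex_frontier convex_simplex)
  then have AE: "AE x in lebesgue. x \<notin> N" by (intro AE_not_in) (simp add: negligible_iff_null_sets)
  define F where "F x = indicator (active_domain \<Omega> \<T>) x *\<^sub>R (gradient u x \<bullet> gradient u x)" for x
  define G where "G x = (\<Sum>T\<in>?A. indicator T x *\<^sub>R (norm (g T x))\<^sup>2)" for x
  have GF: "G x = F x" if x: "x \<notin> N" for x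
  proof (cases "x \<in> active_domain \<Omega> \<T>")
    case True
    then obtain S where S: "S \<in> ?A" "x \<in> S" by (auto simp: active_domain_def)
    have int: "x \<in> interior T" if "T \<in> ?A" "x \<in> T" for T
      using that x closure_subset[of T] by (auto simp: N_def frontier_def)
    have "x \<in> T \<longleftrightarrow> T = S" if "T \<in> ?A" for T
      using unique[OF that S(1)] int S that by blast
    then have "G x = (\<Sum>T\<in>?A. if T = S then (norm (g T x))\<^sup>2 else 0)"
      unfolding G_def by (intro sum.cong) auto
    also have "\<dots> = (norm (g S x))\<^sup>2" using fin S(1) by simp
    also have "g S x = gradient u x"
      using gradient_eq_on_open[of "interior S" x u "p S" "g S x"] int[OF S] interior_subset[of S] p[OF S(1)] g[OF S(1)]
      by (simp add: subset_iff)
    finally show ?thesis using True by (simp add: F_def power2_norm_eq_inner)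
  next
    case False
    then show ?thesis by (auto simp: F_def G_def active_domain_def intro!: sum.neutral)
  qed
  have I: "integrable lebesgue (\<lambda>x. indicator T x *\<^sub>R (norm (g T x))\<^sup>2)" if "T \<in> ?A" for T
  proof -
    have "compact T" using compact_simplex simp that sub by blast
    moreover have "continuous_on UNIV (\<lambda>x. (norm (g T x))\<^sup>2)" by (intro continuous_intros cont that)
    ultimately show ?thesis using set_integrable_continuous_compact(2) by (simp add: set_integrable_def)
  qed
  have "integrable lebesgue G" unfolding G_def using I by (rule Bochner_Integration.integrable_sum)
  then have Gm: "G \<in> borel_measurable lebesgue" by (rule borel_measurable_integrable)
  have AE': "AE x in lebesgue. G x = F x" using AE by eventually_elim (rule GF)
  have "dirichlet_form \<Omega> \<T> u u = (LINT x|lebesgue. F x)"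
    by (simp add: dirichlet_form_def L2_inner_def set_lebesgue_integral_def F_def)
  also have "\<dots> = (LINT x|lebesgue. G x)"
    \<comment> \<open>\<open>F\<close> inherits measurability from \<open>G\<close> through equality
      almost everywhere.\<close>
    using AE' by (intro integral_cong_AE borel_measurable_AE[OF Gm AE'] Gm) auto
  also have "\<dots> = (\<Sum>T\<in>?A. LINT x:T|lebesgue. (norm (g T x))\<^sup>2)"
    unfolding G_def set_lebesgue_integral_def using I by (rule Bochner_Integration.integral_sum)
  finally show ?thesis .
qed

section \<open>Bounds for the boundary term\<close>

lemma L2_inner_self_nonneg: "0 \<le> L2_inner M S u u"
  unfolding L2_inner_def set_lebesgue_integral_def by (intro integral_nonneg_AE) auto

text \<open>A closed set is measurable for the Hausdorff measure, so the bound on the outer measure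
  is a bound on the measure of \<open>S\<close>.\<close>

lemma L2_inner_surface_le:
  fixes u :: "real ^ 'd \<Rightarrow> real"
  assumes S: "closed S" and outer: "hausdorff_outer (CARD('d) - 1) S \<le> ennreal A" and A: "0 \<le> A" and B: "0 \<le> B"
    and u: "\<And>x. x \<in> S \<Longrightarrow> (u x)\<^sup>2 \<le> B"
  shows "L2_inner surface_measure S u u \<le> A * B"
proof -
  let ?M = "surface_measure :: (real^'d) measure"
  have SM: "S \<in> sets ?M" by (rule closed_in_hausdorff_sets[OF S])
  have em: "emeasure ?M S \<le> ennreal A" using emeasure_hausdorff_measure[OF SM] outer by simp
  then have fin: "emeasure ?M S < \<infinity>" using ennreal_less_top le_less_trans by (metis infinity_ennreal_def)
  have int: "integrable ?M (\<lambda>x. indicator S x *\<^sub>R B)"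
    using SM fin by (intro integrable_scaleR_left integrable_real_indicator)
  have "L2_inner ?M S u u \<le> (LINT x|?M. indicator S x *\<^sub>R B)"
    unfolding L2_inner_def set_lebesgue_integral_def
    \<comment> \<open>Only the majorant must be integrable: if the square of \<open>u\<close> were
      not, its integral would be the default \<open>0\<close>, still below the bound.\<close>
    by (rule integral_mono_AE'[OF int]) (use u B in \<open>auto simp: indicator_def power2_eq_square\<close>)
  also have "\<dots> = measure ?M S * B" using SM fin by (simp add: less_top[symmetric])
  also have "\<dots> \<le> A * B"
    using em A B by (intro mult_right_mono) (auto simp: measure_def enn2real_leI)
  finally show ?thesis .
qed

lemma weighted_boundary_form_nonneg:
  assumes "simplicial_mesh \<Omega>s \<T>"
  shows "0 \<le> weighted_boundary_form \<Omega> \<T> u u"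
proof -
  have "0 \<le> diameter T" if "T \<in> cut_mesh \<Omega> \<T>" for T
    using assms that compact_imp_bounded compact_simplex diameter_ge_0
    unfolding simplicial_mesh_def cut_mesh_def active_mesh_def by blast
  then show ?thesis
    unfolding weighted_boundary_form_def
    by (intro sum_nonneg mult_nonneg_nonneg L2_inner_self_nonneg) simp
qed

text \<open>A cut cell meets \<open>\<partial>\<Omega>\<^sub>h\<close>, so a function of \<open>V\<^sub>h\<^sup>0\<close> has a zero in every cut cell. This gives
  the Poincare type bound cell by cell.\<close>

lemma weighted_boundary_form_le_dirichlet:
  fixes \<Omega> :: "(real ^ 'd) set"
  assumes dom: "lipschitz_domain \<Omega>" "bounded \<Omega>"
  shows "\<exists>K\<ge>0. \<forall>\<Omega>s \<T>. \<forall>u\<in>fe_space0 \<Omega> \<T> k. simplicial_mesh \<Omega>s \<T> \<longrightarrow> shape_regular \<sigma> \<T> \<longrightarrow>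
    boundary_resolved \<Omega> \<T> \<longrightarrow> weighted_boundary_form \<Omega> \<T> u u \<le> K * dirichlet_form \<Omega> \<T> u u"
proof -
  define d where "d = CARD('d)"
  have d: "d > 0" unfolding d_def by simp
  obtain C where C: "0 \<le> C" "\<forall>S h. 0 \<le> h \<longrightarrow> (\<forall>x\<in>S. \<forall>y\<in>S. dist x y \<le> h) \<longrightarrow>
      hausdorff_outer (d - 1) (S \<inter> frontier \<Omega>) \<le> ennreal (C * h ^ (d - 1))"
    using hausdorff_outer_frontier_le[OF dom] unfolding d_def[symmetric] by (elim exE conjE) (rule that)
  obtain P where P: "0 \<le> P" "\<forall>p\<in>polys k :: (real ^ 'd \<Rightarrow> real) set. \<forall>g T. continuous_on UNIV g \<longrightarrow>
     (\<forall>x. GDERIV p x :> g x) \<longrightarrow> compact T \<longrightarrow> convex T \<longrightarrow>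
     (\<forall>x\<in>T. (norm (g x))\<^sup>2 * measure lebesgue T \<le> P * (LINT y:T|lebesgue. (norm (g y))\<^sup>2))"
    using gradient_sup_le_mean_square[of k, where 'd = 'd] by (elim exE conjE) (rule that)
  \<comment> \<open>Chosen so that \<open>v * h ^ d\<close> is the lower bound of
    \<open>shape_regular_simplex\<close> for a cell of diameter \<open>h\<close>.\<close>
  define v where "v = unit_ball_vol (real d) / (4 * \<bar>\<sigma>\<bar> + 1) ^ d"
  have v: "v > 0" by (simp add: v_def)
  define K where "K = C * P / v"
  have K: "0 \<le> K" using C P v by (simp add: K_def)
  have "weighted_boundary_form \<Omega> \<T> u u \<le> K * dirichlet_form \<Omega> \<T> u u"
    if u: "u \<in> fe_space0 \<Omega> \<T> k" and mesh: "simplicial_mesh \<Omega>s \<T>" and reg: "shape_regular \<sigma> \<T>"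
      and res: "boundary_resolved \<Omega> \<T>" for \<Omega>s \<T> u
  proof -
    let ?A = "active_mesh \<Omega> \<T>"
    have fe: "\<forall>T\<in>?A. \<exists>p\<in>polys k. \<forall>x\<in>T. u x = p x"
      using u unfolding fe_space0_def fe_space_def mem_Collect_eq by (elim conjE)
    have "\<exists>p g. p \<in> polys k \<and> (\<forall>x\<in>T. u x = p x) \<and> continuous_on UNIV g \<and> (\<forall>x. GDERIV p x :> g x)"
      if "T \<in> ?A" for T
    proof -
      from bspec[OF fe that] obtain p where p: "p \<in> polys k" "\<forall>x\<in>T. u x = p x" by (rule bexE)
      obtain g where "continuous_on UNIV g" "\<forall>x. GDERIV p x :> g x"
        using polys_continuously_differentiable[OF p(1)] by (elim exE conjE)
      with p show ?thesis by (intro exI[of _ p] exI[of _ g] conjI)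
    qed
    then obtain p g where pg: "\<And>T. T \<in> ?A \<Longrightarrow> p T \<in> polys k \<and> (\<forall>x\<in>T. u x = p T x) \<and>
        continuous_on UNIV (g T) \<and> (\<forall>x. GDERIV (p T) x :> g T x)" by metis
    define I where "I T = (LINT y:T|lebesgue. (norm (g T y))\<^sup>2)" for T
    have I: "0 \<le> I T" for T
      unfolding I_def set_lebesgue_integral_def by (intro integral_nonneg_AE) auto
    have D: "dirichlet_form \<Omega> \<T> u u = sum I ?A"
      unfolding I_def by (rule dirichlet_form_eq_sum[OF mesh, where p = p]) (use pg in auto)
    have sub: "cut_mesh \<Omega> \<T> \<subseteq> ?A" "?A \<subseteq> \<T>" by (auto simp: cut_mesh_def active_mesh_def)
    have fin: "finite ?A"
      using mesh sub(2) finite_subset by (auto simp: simplicial_mesh_def triangulation_def)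
    have cell: "inverse (diameter T) * L2_inner surface_measure (T \<inter> frontier \<Omega>) u u \<le> K * I T"
      if T: "T \<in> cut_mesh \<Omega> \<T>" for T
    proof -
      define h where "h = diameter T"
      have TA: "T \<in> ?A" and TT: "T \<in> \<T>" using T sub by auto
      have simp: "int CARD('d) simplex T" using mesh TT by (simp add: simplicial_mesh_def)
      have comp: "compact T" and conv: "convex T" using simp compact_simplex convex_simplex by blast+
      note bdd = compact_imp_bounded[OF comp]
      have "diameter T \<le> \<sigma> * inball_diameter T" using reg TT by (simp add: shape_regular_def)
      note geo = shape_regular_simplex[OF simp this]
      have h: "h > 0" and vol: "v * h ^ d \<le> measure lebesgue T"
        using geo by (simp_all add: h_def v_def d_def power_divide)
      have volpos: "0 < v * h ^ d" using v h by simp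
      have dist_le: "dist x y \<le> h" if "x \<in> T" "y \<in> T" for x y
        unfolding h_def using diameter_bounded_bound[OF bdd that] .
      \<comment> \<open>Resolution of the boundary turns contact with
        \<open>frontier \<Omega>\<close> into contact with the boundary of the active domain, where
        \<open>u\<close> vanishes.\<close>
      have "T \<inter> frontier (active_domain \<Omega> \<T>) \<noteq> {}" using res T unfolding boundary_resolved_def by blast
      then obtain x0 where x0: "x0 \<in> T" "x0 \<in> frontier (active_domain \<Omega> \<T>)" by blast
      then have "u x0 = 0" using u by (simp add: fe_space0_def)
      then have px0: "p T x0 = 0" using pg[OF TA] x0(1) by simp
      \<comment> \<open>The mean square bound on the squared gradient, with the volume of the cell
        replaced by its lower bound.\<close>
      define B where "B = P * I T / (v * h ^ d)"
      have B: "0 \<le> B" using P I[of T] volpos by (simp add: B_def)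
      have gB: "(norm (g T y))\<^sup>2 \<le> B" if "y \<in> T" for y
      proof -
        have "(norm (g T y))\<^sup>2 * (v * h ^ d) \<le> (norm (g T y))\<^sup>2 * measure lebesgue T"
          using vol by (intro mult_left_mono) auto
        also have "\<dots> \<le> P * I T"
          unfolding I_def using pg[OF TA] comp conv that by (intro P(2)[rule_format]) auto
        finally show ?thesis unfolding B_def using volpos by (simp only: pos_le_divide_eq)
      qed
      have uB: "(u x)\<^sup>2 \<le> h\<^sup>2 * B" if "x \<in> T" for x
        using square_le_of_zero[of "p T" "g T" T x x0 h B] pg[OF TA] conv that x0(1) px0 dist_le B gB by simp
      have "L2_inner surface_measure (T \<inter> frontier \<Omega>) u u \<le> (C * h ^ (d - 1)) * (h\<^sup>2 * B)"
      proof (rule L2_inner_surface_le)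
        show "closed (T \<inter> frontier \<Omega>)" using compact_imp_closed[OF comp] by (intro closed_Int) auto
        show "hausdorff_outer (CARD('d) - 1) (T \<inter> frontier \<Omega>) \<le> ennreal (C * h ^ (d - 1))"
          using C(2)[rule_format, of h T] dist_le h unfolding d_def by simp
      qed (use C(1) h B uB in auto)
      then have "inverse h * L2_inner surface_measure (T \<inter> frontier \<Omega>) u u
          \<le> inverse h * ((C * h ^ (d - 1)) * (h\<^sup>2 * B))"
        using h by (intro mult_left_mono) auto
      also have "\<dots> = K * I T"
      proof -
        \<comment> \<open>The powers \<open>-1\<close>, \<open>d - 1\<close>, \<open>2\<close> and
          \<open>-d\<close> of \<open>h\<close> add up to zero; writing \<open>d\<close> as a
          successor removes the truncated subtraction.\<close>
        obtain m where m: "d = Suc m" using d gr0_implies_Suc by blast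
        show ?thesis unfolding B_def K_def m using h v by (simp add: field_simps power2_eq_square)
      qed
      finally show ?thesis by (simp add: h_def)
    qed
    have "weighted_boundary_form \<Omega> \<T> u u \<le> (\<Sum>T\<in>cut_mesh \<Omega> \<T>. K * I T)"
      unfolding weighted_boundary_form_def by (intro sum_mono cell)
    also have "\<dots> \<le> (\<Sum>T\<in>?A. K * I T)" using K I fin sub(1) by (intro sum_mono2) auto
    also have "\<dots> = K * dirichlet_form \<Omega> \<T> u u" by (simp add: D sum_distrib_left)
    finally show ?thesis .
  qed
  with K show ?thesis by (intro exI[of _ K] conjI allI ballI impI)
qed

section \<open>Uniform equivalence with the Dirichlet form\<close>

lemma polyhedral_domain_bounded:
  assumes "polyhedral_domain D"
  shows "bounded D"
proof -
  obtain \<P> where "finite \<P>" "\<forall>P\<in>\<P>. polytope P" "D = interior (\<Union>\<P>)"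
    using assms unfolding polyhedral_domain_def by blast
  then show ?thesis
    by (metis bounded_Union bounded_subset interior_subset polytope_imp_bounded)
qed

text \<open>Uniformity is expressed by the order of quantifiers: \<open>c1\<close> and
  \<open>c2\<close> precede the background domain and the mesh family. The background equivalence of
  \<open>cutfem_form\<close> with \<open>norm_b_squared\<close> enters as a premise with constants
  \<open>C1\<close> and \<open>C2\<close>. The operators are any \<open>A0\<close> and
  \<open>L0\<close> representing the two forms.\<close>

theorem mainTheorem4:
  fixes \<Omega> :: "(real ^ 'd) set" and k :: nat and \<gamma> \<beta> \<sigma> C1 C2 :: real
  assumes dim: "CARD('d) \<in> {2, 3}"
    and domain: "lipschitz_domain \<Omega>"
    and degree: "k \<ge> 1"
    and params: "\<gamma> > 0" "\<beta> > 0"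
    and equiv_consts: "C1 > 0" "C2 > 0"
  shows "\<exists>c1>0. \<exists>c2>0. \<forall>\<Omega>s H. \<forall>\<T> :: real \<Rightarrow> (real ^ 'd) set set.
    polyhedral_domain \<Omega>s \<and> \<Omega> \<subseteq> \<Omega>s \<and> H \<subseteq> {0<..} \<and>
    (\<forall>h\<in>H. simplicial_mesh \<Omega>s (\<T> h) \<and> shape_regular \<sigma> (\<T> h) \<and> boundary_resolved \<Omega> (\<T> h)) \<and>
    (\<forall>h\<in>H. \<forall>v\<in>fe_space \<Omega> (\<T> h) k.
        C1 * norm_b_squared \<Omega> (\<T> h) \<gamma> v \<le> cutfem_form \<Omega> (\<T> h) k \<gamma> \<beta> v v \<and>
        cutfem_form \<Omega> (\<T> h) k \<gamma> \<beta> v v \<le> C2 * norm_b_squared \<Omega> (\<T> h) \<gamma> v) \<longrightarrow>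
    (\<forall>h\<in>H.
      (\<forall>u\<in>fe_space0 \<Omega> (\<T> h) k.
        c1 * dirichlet_form \<Omega> (\<T> h) u u \<le> cutfem_form \<Omega> (\<T> h) k \<gamma> \<beta> u u \<and>
        cutfem_form \<Omega> (\<T> h) k \<gamma> \<beta> u u \<le> c2 * dirichlet_form \<Omega> (\<T> h) u u) \<and>
      (\<forall>A0. represents_form (active_domain \<Omega> (\<T> h)) (fe_space0 \<Omega> (\<T> h) k)
              (cutfem_form \<Omega> (\<T> h) k \<gamma> \<beta>) A0 \<longrightarrow>
        (\<forall>u\<in>fe_space0 \<Omega> (\<T> h) k.
          L2_inner lebesgue (active_domain \<Omega> (\<T> h)) (A0 u) u = cutfem_form \<Omega> (\<T> h) k \<gamma> \<beta> u u) \<and>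
        (\<forall>L0. represents_form (active_domain \<Omega> (\<T> h)) (fe_space0 \<Omega> (\<T> h) k)
                (dirichlet_form \<Omega> (\<T> h)) L0 \<longrightarrow>
          (\<forall>u\<in>fe_space0 \<Omega> (\<T> h) k.
            c1 * L2_inner lebesgue (active_domain \<Omega> (\<T> h)) (L0 u) u
              \<le> L2_inner lebesgue (active_domain \<Omega> (\<T> h)) (A0 u) u \<and>
            L2_inner lebesgue (active_domain \<Omega> (\<T> h)) (A0 u) u
              \<le> c2 * L2_inner lebesgue (active_domain \<Omega> (\<T> h)) (L0 u) u))))"
proof -
  \<comment> \<open>\<open>K\<close> must be fixed before the background domain, but
    \<open>\<Omega>\<close> is known to be bounded only through that domain. So boundedness stays a
    premise of the estimate; for unbounded \<open>\<Omega>\<close> any nonnegative \<open>K\<close>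
    serves.\<close>
  obtain K where K: "K \<ge> 0" "bounded \<Omega> \<Longrightarrow> \<forall>\<Omega>s \<T>. \<forall>u\<in>fe_space0 \<Omega> \<T> k. simplicial_mesh \<Omega>s \<T> \<longrightarrow>
      shape_regular \<sigma> \<T> \<longrightarrow> boundary_resolved \<Omega> \<T> \<longrightarrow>
      weighted_boundary_form \<Omega> \<T> u u \<le> K * dirichlet_form \<Omega> \<T> u u"
    using weighted_boundary_form_le_dirichlet[OF domain, of k \<sigma>] by (cases "bounded \<Omega>") auto
  \<comment> \<open>The boundary term is at most \<open>K\<close> times the Dirichlet form, so
    \<open>norm_b_squared\<close> is at most \<open>1 + \<gamma> * K\<close> times it. For the lower
    bound the nonnegative boundary term is dropped and \<open>C1\<close> is kept.\<close>
  define c2 where "c2 = C2 * (1 + \<gamma> * K)"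
  have c2: "c2 > 0" using K(1) params(1) equiv_consts(2) by (simp add: c2_def add_pos_nonneg)
  show ?thesis
  proof (rule exI[of _ C1], rule conjI[OF equiv_consts(1)], rule exI[of _ c2], rule conjI[OF c2],
      intro allI impI, elim conjE, rule ballI, rule conjI)
    fix \<Omega>s H and \<T> :: "real \<Rightarrow> (real ^ 'd) set set" and h
    assume poly: "polyhedral_domain \<Omega>s" "\<Omega> \<subseteq> \<Omega>s"
      and mesh: "\<forall>h\<in>H. simplicial_mesh \<Omega>s (\<T> h) \<and> shape_regular \<sigma> (\<T> h) \<and> boundary_resolved \<Omega> (\<T> h)"
      and equiv: "\<forall>h\<in>H. \<forall>v\<in>fe_space \<Omega> (\<T> h) k.
        C1 * norm_b_squared \<Omega> (\<T> h) \<gamma> v \<le> cutfem_form \<Omega> (\<T> h) k \<gamma> \<beta> v v \<and>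
        cutfem_form \<Omega> (\<T> h) k \<gamma> \<beta> v v \<le> C2 * norm_b_squared \<Omega> (\<T> h) \<gamma> v"
      and h: "h \<in> H"
    let ?V = "fe_space0 \<Omega> (\<T> h) k" and ?a = "cutfem_form \<Omega> (\<T> h) k \<gamma> \<beta>"
      and ?D = "dirichlet_form \<Omega> (\<T> h)" and ?W = "weighted_boundary_form \<Omega> (\<T> h)"
    have bdd: "bounded \<Omega>" using polyhedral_domain_bounded poly bounded_subset by blast
    have bounds: "C1 * ?D u u \<le> ?a u u \<and> ?a u u \<le> c2 * ?D u u" if u: "u \<in> ?V" for u
    proof
      have "u \<in> fe_space \<Omega> (\<T> h) k" using u by (simp add: fe_space0_def)
      then have e: "C1 * (?D u u + \<gamma> * ?W u u) \<le> ?a u u" "?a u u \<le> C2 * (?D u u + \<gamma> * ?W u u)"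
        using equiv h by (auto simp: norm_b_squared_def)
      have "0 \<le> \<gamma> * ?W u u"
        using weighted_boundary_form_nonneg[of \<Omega>s "\<T> h"] mesh h params(1)
        by (intro mult_nonneg_nonneg) auto
      then have "C1 * ?D u u \<le> C1 * (?D u u + \<gamma> * ?W u u)"
        using equiv_consts(1) by (intro mult_left_mono) auto
      with e(1) show "C1 * ?D u u \<le> ?a u u" by linarith
      have "?W u u \<le> K * ?D u u" using K(2)[OF bdd] u mesh h by blast
      then have "C2 * (?D u u + \<gamma> * ?W u u) \<le> C2 * (?D u u + \<gamma> * (K * ?D u u))"
        using equiv_consts(2) params(1) by (intro mult_left_mono add_left_mono) auto
      with e(2) show "?a u u \<le> c2 * ?D u u" by (simp add: c2_def algebra_simps)
    qed
    then show "\<forall>u\<in>?V. C1 * ?D u u \<le> ?a u u \<and> ?a u u \<le> c2 * ?D u u" by blast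
    show "\<forall>A0. represents_form (active_domain \<Omega> (\<T> h)) ?V ?a A0 \<longrightarrow>
        (\<forall>u\<in>?V. L2_inner lebesgue (active_domain \<Omega> (\<T> h)) (A0 u) u = ?a u u) \<and>
        (\<forall>L0. represents_form (active_domain \<Omega> (\<T> h)) ?V ?D L0 \<longrightarrow>
          (\<forall>u\<in>?V.
            C1 * L2_inner lebesgue (active_domain \<Omega> (\<T> h)) (L0 u) u
              \<le> L2_inner lebesgue (active_domain \<Omega> (\<T> h)) (A0 u) u \<and>
            L2_inner lebesgue (active_domain \<Omega> (\<T> h)) (A0 u) u
              \<le> c2 * L2_inner lebesgue (active_domain \<Omega> (\<T> h)) (L0 u) u))"
      \<comment> \<open>Testing the representations with \<open>v = u\<close> turns the two L2
        pairings into the forms, so \<open>bounds\<close> carries over to the operators.\<close>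
      using bounds by (simp add: represents_form_def)
  qed
qed

end
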